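(* Let $l\geq1$ and $$X=S^k\times\underbrace{S^1\times\dots\times S^1}_{l-1}.$$ If $k\geq l^{\,l^4}$, then there exists an immersion $F:X\hookrightarrow B^{k+l}(1)$ with $$curv^\perp_F(X)\leq1+2\sqrt{\frac{3l-3}{l+1}}<4.5.$$
   Context: $B^{N}(1)\subset\mathbb R^{N}$ is the unit ball. For an immersion $F:X\hookrightarrow Y$ into a Riemannian manifold, $curv^\perp_F(X)$ is the supremum of the $Y$-curvatures of the geodesics of $X$ for the induced metric (equivalently, the supremum of $\|\mathrm{II}(\tau,\tau)\|$ over unit tangent vectors $\tau$ to $X$, where $\mathrm{II}$ is the second fundamental form). *)

theory Defs
  imports "HOL-Analysis.Analysis"
begin

text \<open>
  \<open>Ck_on n S f\<close> is meant for open \<open>S\<close> and a finite-dimensional domain, where continuity of all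
  iterated directional derivatives is the usual \<open>C\<^sup>n\<close> condition.
\<close>

primrec Ck_on ::
  "nat \<Rightarrow> 'a::real_normed_vector set \<Rightarrow> ('a \<Rightarrow> 'b::real_normed_vector) \<Rightarrow> bool" where
  "Ck_on 0 S f \<longleftrightarrow> continuous_on S f"
| "Ck_on (Suc n) S f \<longleftrightarrow>
     (\<forall>x\<in>S. f differentiable (at x)) \<and> (\<forall>v. Ck_on n S (\<lambda>x. frechet_derivative f (at x) v))"

definition smooth_on :: "'a::real_normed_vector set \<Rightarrow> ('a \<Rightarrow> 'b::real_normed_vector) \<Rightarrow> bool" where
  "smooth_on S f \<longleftrightarrow> (\<forall>n. Ck_on n S f)"

text \<open>
  Manifolds are embedded submanifolds \<open>X\<close> of a Euclidean space. A map on \<open>X\<close> is smooth iff it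
  locally extends to a smooth map of the ambient space.
\<close>

definition smooth_map :: "'a::euclidean_space set \<Rightarrow> ('a \<Rightarrow> 'b::euclidean_space) \<Rightarrow> bool" where
  "smooth_map X f \<longleftrightarrow>
     (\<forall>p\<in>X. \<exists>U g. open U \<and> p \<in> U \<and> smooth_on U g \<and> (\<forall>x\<in>X \<inter> U. g x = f x))"

definition tangent_space :: "'a::euclidean_space set \<Rightarrow> 'a \<Rightarrow> 'a set" where
  "tangent_space X p =
     {v. \<exists>\<gamma> :: real \<Rightarrow> 'a. smooth_on UNIV \<gamma> \<and> range \<gamma> \<subseteq> X \<and> \<gamma> 0 = p
           \<and> (\<gamma> has_vector_derivative v) (at 0)}"

text \<open>
  A derivative within \<open>X\<close> is not unique as a linear map on the ambient space, but its values on
  \<open>tangent_space X p\<close> are; the differential is only ever applied to tangent vectors.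
\<close>

definition differential ::
  "'a::euclidean_space set \<Rightarrow> ('a \<Rightarrow> 'b::euclidean_space) \<Rightarrow> 'a \<Rightarrow> 'a \<Rightarrow> 'b" where
  "differential X f p = frechet_derivative f (at p within X)"

definition immersion_on :: "'a::euclidean_space set \<Rightarrow> ('a \<Rightarrow> 'b::euclidean_space) \<Rightarrow> bool" where
  "immersion_on X f \<longleftrightarrow>
     smooth_map X f \<and> (\<forall>p\<in>X. inj_on (differential X f p) (tangent_space X p))"

definition normal_component :: "'b::euclidean_space set \<Rightarrow> 'b \<Rightarrow> 'b" where
  "normal_component W y = (THE n. (\<forall>w\<in>W. orthogonal n w) \<and> y - n \<in> W)"

definition tangent_field :: "'a::euclidean_space set \<Rightarrow> ('a \<Rightarrow> 'a) \<Rightarrow> bool" where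
  "tangent_field X V \<longleftrightarrow> smooth_map X V \<and> (\<forall>q\<in>X. V q \<in> tangent_space X q)"

text \<open>
  \<open>II(u,v)\<close> is the part normal to \<open>f\<close> at \<open>p\<close> of the derivative in direction \<open>u\<close> of the field
  \<open>df(V)\<close> along \<open>f\<close>, for any tangent field \<open>V\<close> of \<open>X\<close> with \<open>V p = v\<close>; as usual, it does not
  depend on \<open>V\<close>.
\<close>

definition second_fundamental_form ::
  "'a::euclidean_space set \<Rightarrow> ('a \<Rightarrow> 'b::euclidean_space) \<Rightarrow> 'a \<Rightarrow> 'a \<Rightarrow> 'a \<Rightarrow> 'b" where
  "second_fundamental_form X f p u v =
     (let V = (SOME V. tangent_field X V \<and> V p = v)
      in normal_component (differential X f p ` tangent_space X p)
           (differential X (\<lambda>q. differential X f q (V q)) p u))"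

text \<open>Tangent vectors are normalised in the metric induced by \<open>f\<close>.\<close>

definition curv_perp :: "'a::euclidean_space set \<Rightarrow> ('a \<Rightarrow> 'b::euclidean_space) \<Rightarrow> ereal" where
  "curv_perp X f =
     (SUP (p, \<tau>) \<in> {(p, \<tau>). p \<in> X \<and> \<tau> \<in> tangent_space X p \<and> norm (differential X f p \<tau>) = 1}.
        ereal (norm (second_fundamental_form X f p \<tau> \<tau>)))"

text \<open>
  The product of circles indexed by \<open>J\<close>; the coordinates outside \<open>J\<close> are unused and set to \<open>0\<close>,
  so that \<open>J = {}\<close> gives a point (a type-indexed product could not be empty).
\<close>

definition torus :: "'n::finite set \<Rightarrow> (complex ^ 'n) set" where
  "torus J = {z. (\<forall>j\<in>J. z $ j \<in> sphere 0 1) \<and> (\<forall>j. j \<notin> J \<longrightarrow> z $ j = 0)}"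

end

theory Submission
  imports Defs
begin

text \<open>
  Put \<open>n = l - 1\<close> and \<open>c = sqrt (3 * n / (n + 2))\<close>, so that the bound to be proved is \<open>1 + 2 * c\<close>.
  The immersion is a tube around a torus.

  Suppose that a torus of dimension \<open>n\<close> is immersed in the unit sphere of \<open>\<real>\<^sup>k\<^sup>+\<^sup>l\<close> with curvature at
  most \<open>c\<close> and trivial normal bundle, necessarily of rank \<open>k + 1\<close>. Shrink it by the factor
  \<open>2 * c / (1 + 2 * c)\<close> and take the boundary of its tubular neighbourhood of radius \<open>1 / (1 + 2 * c)\<close>.
  This is an immersed product of a \<open>k\<close>-sphere and the torus in the unit ball, and the radii balance
  the principal curvatures in the fibres against those along the core: all of them are at most
  \<open>1 + 2 * c\<close> in absolute value. As the tube is a hypersurface, its second fundamental form is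
  read off from the derivative of the unit normal (\<open>norm_second_fundamental_form_tube\<close>), which reduces
  the curvature bound to an inequality of inner products (\<open>shape_operator_bound\<close>).

  The torus is an orbit of an orthogonal representation that is a sum of planes on which the torus
  acts by characters, that is, by integral vectors \<open>m\<close>. Since the normal bundle of an orbit is moved
  around by the group, it is trivial. Speed and acceleration of the one-parameter orbits are the
  second and fourth moments of the vectors \<open>m\<close>, weighted by the squared coordinates of the base point
  (\<open>tube_immersion_exists\<close>). If the \<open>m\<close> have equal length and form a design of degree four, then
  these moments are those of a round sphere and their ratio gives exactly the curvature \<open>c\<close>
  (\<open>mean_pairing_square\<close>, \<open>mean_pairing_quartic\<close>).

  Such designs exist among the integral vectors of a fixed length (\<open>exists_quartic_design\<close>): for
  weights invariant under signed permutations only the mean of the sum of fourth powers of the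
  coordinates matters, and the required value lies between those of a constant vector and of a
  vector with one dominant entry. The squared length can be taken at most \<open>25 * n\<close>, so there are at
  most \<open>(50 * n + 1)\<^sup>n\<close> such vectors; the lower bound on \<open>k\<close> leaves room for that many planes.
\<close>

section \<open>Globally smooth maps\<close>

lemma Ck_on_SucI:
  assumes "\<And>x. (f has_derivative f' x) (at x)" "\<And>v. Ck_on n UNIV (\<lambda>x. f' x v)"
  shows "Ck_on (Suc n) UNIV f"
proof -
  have "frechet_derivative f (at x) = f' x" for x
    using frechet_derivative_at[OF assms(1)] by simp
  then show ?thesis
    using assms by (auto simp: differentiable_def)
qed

lemma Ck_on_SucD:
  assumes "Ck_on (Suc n) UNIV f"
  shows "(f has_derivative frechet_derivative f (at x)) (at x)"
    and "Ck_on n UNIV (\<lambda>x. frechet_derivative f (at x) v)"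
  using assms by (auto simp: frechet_derivative_works)

lemma Ck_on_Suc_imp: "Ck_on (Suc n) S f \<Longrightarrow> Ck_on n S f"
proof (induction n arbitrary: f)
  case 0
  then show ?case
    by (auto intro!: continuous_at_imp_continuous_on differentiable_imp_continuous_within)
next
  case (Suc n)
  then show ?case
    by (metis Ck_on.simps(2))
qed

lemma smooth_on_imp_differentiable:
  assumes "smooth_on S f" "x \<in> S"
  shows "f differentiable (at x)"
    and "(\<lambda>x. frechet_derivative f (at x) v) differentiable (at x)"
  using assms(1)[unfolded smooth_on_def, rule_format, of "Suc (Suc 0)"] assms(2) by auto

lemma smooth_on_imp_has_derivative:
  "smooth_on S f \<Longrightarrow> x \<in> S \<Longrightarrow> (f has_derivative frechet_derivative f (at x)) (at x)"
  using smooth_on_imp_differentiable(1) frechet_derivative_works by blast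

lemma Ck_on_const: "Ck_on n UNIV (\<lambda>x. c)"
  by (induction n arbitrary: c) auto

lemma Ck_on_add:
  "Ck_on n UNIV f \<Longrightarrow> Ck_on n UNIV g \<Longrightarrow> Ck_on n UNIV (\<lambda>x. f x + g x)"
proof (induction n arbitrary: f g)
  case (Suc n)
  note f = Ck_on_SucD[OF Suc.prems(1)] and g = Ck_on_SucD[OF Suc.prems(2)]
  show ?case
    by (rule Ck_on_SucI[OF has_derivative_add[OF f(1) g(1)]]) (rule Suc.IH[OF f(2) g(2)])
qed (auto intro: continuous_on_add)

lemma Ck_on_bounded_linear:
  assumes h: "bounded_linear h"
  shows "Ck_on n UNIV f \<Longrightarrow> Ck_on n UNIV (\<lambda>x. h (f x))"
proof (induction n arbitrary: f)
  case 0
  then show ?case using bounded_linear.continuous_on[OF h] by auto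
next
  case (Suc n)
  note f = Ck_on_SucD[OF Suc.prems(1)]
  show ?case
    by (rule Ck_on_SucI[OF bounded_linear.has_derivative[OF h f(1)]]) (rule Suc.IH[OF f(2)])
qed

text \<open>
  By Leibniz' rule the derivative is a sum of products in which one factor is not differentiated;
  the induction hypothesis applies to that factor because \<open>C\<^sup>n\<^sup>+\<^sup>1\<close> implies \<open>C\<^sup>n\<close>.
\<close>

lemma Ck_on_bilinear:
  assumes h: "bounded_bilinear h"
  shows "Ck_on n UNIV f \<Longrightarrow> Ck_on n UNIV g \<Longrightarrow> Ck_on n UNIV (\<lambda>x. h (f x) (g x))"
proof (induction n arbitrary: f g)
  case 0
  then show ?case using bounded_bilinear.continuous_on[OF h] by auto
next
  case (Suc n)
  note f = Ck_on_SucD[OF Suc.prems(1)] and g = Ck_on_SucD[OF Suc.prems(2)]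
  show ?case
    by (rule Ck_on_SucI[OF bounded_bilinear.FDERIV[OF h f(1) g(1)]])
       (intro Ck_on_add Suc.IH f(2) g(2) Ck_on_Suc_imp[OF Suc.prems(1)] Ck_on_Suc_imp[OF Suc.prems(2)])
qed

lemma Ck_on_compose_linear:
  assumes h: "bounded_linear h"
  shows "Ck_on n UNIV f \<Longrightarrow> Ck_on n UNIV (\<lambda>x. f (h x))"
proof (induction n arbitrary: f)
  case 0
  then show ?case
    using continuous_on_compose2[of UNIV f UNIV h] linear_continuous_on[OF h] by auto
next
  case (Suc n)
  note f = Ck_on_SucD[OF Suc.prems]
  show ?case
    by (rule Ck_on_SucI[OF has_derivative_compose[OF bounded_linear_imp_has_derivative[OF h] f(1)]])
       (rule Suc.IH[OF f(2)])
qed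

lemma smooth_const: "smooth_on UNIV (\<lambda>x. c)"
  by (simp add: smooth_on_def Ck_on_const)

lemma smooth_add:
  "smooth_on UNIV f \<Longrightarrow> smooth_on UNIV g \<Longrightarrow> smooth_on UNIV (\<lambda>x. f x + g x)"
  by (simp add: smooth_on_def Ck_on_add)

lemma smooth_bounded_linear:
  "bounded_linear h \<Longrightarrow> smooth_on UNIV f \<Longrightarrow> smooth_on UNIV (\<lambda>x. h (f x))"
  by (simp add: smooth_on_def Ck_on_bounded_linear)

lemma smooth_bilinear:
  "bounded_bilinear h \<Longrightarrow> smooth_on UNIV f \<Longrightarrow> smooth_on UNIV g \<Longrightarrow>
    smooth_on UNIV (\<lambda>x. h (f x) (g x))"
  by (simp add: smooth_on_def Ck_on_bilinear)

lemma smooth_compose_linear: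
  "bounded_linear h \<Longrightarrow> smooth_on UNIV f \<Longrightarrow> smooth_on UNIV (\<lambda>x. f (h x))"
  by (simp add: smooth_on_def Ck_on_compose_linear)

lemma smooth_id: "smooth_on UNIV (\<lambda>x. x)"
proof -
  have "Ck_on n UNIV (\<lambda>x::'a. x)" for n
  proof (cases n)
    case 0
    then show ?thesis by (simp add: continuous_on_id)
  next
    case (Suc m)
    have "Ck_on (Suc m) UNIV (\<lambda>x::'a. x)"
    proof (rule Ck_on_SucI[where f' = "\<lambda>x v. v"])
      show "((\<lambda>x. x) has_derivative (\<lambda>v. v)) (at x)" for x :: 'a
        by (rule has_derivative_ident)
    qed (rule Ck_on_const)
    then show ?thesis using Suc by (simp only:)
  qed
  then show ?thesis by (simp add: smooth_on_def)
qed

lemma smooth_linear: "bounded_linear h \<Longrightarrow> smooth_on UNIV h"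
  using smooth_bounded_linear[of h "\<lambda>x. x"] smooth_id by simp

lemma smooth_sum:
  "(\<And>i. i \<in> I \<Longrightarrow> smooth_on UNIV (f i)) \<Longrightarrow> smooth_on UNIV (\<lambda>x. \<Sum>i\<in>I. f i x)"
  by (induction I rule: infinite_finite_induct) (auto intro: smooth_const smooth_add)

lemma smooth_mult:
  fixes f g :: "_ \<Rightarrow> 'b::real_normed_algebra"
  shows "smooth_on UNIV f \<Longrightarrow> smooth_on UNIV g \<Longrightarrow> smooth_on UNIV (\<lambda>x. f x * g x)"
  by (rule smooth_bilinear[OF bounded_bilinear_mult])

lemma smooth_prod:
  fixes f :: "_ \<Rightarrow> _ \<Rightarrow> 'b::real_normed_field"
  shows "(\<And>i. i \<in> I \<Longrightarrow> smooth_on UNIV (f i)) \<Longrightarrow> smooth_on UNIV (\<lambda>x. \<Prod>i\<in>I. f i x)"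
  by (induction I rule: infinite_finite_induct) (auto intro: smooth_const smooth_mult)

lemma smooth_power:
  fixes f :: "_ \<Rightarrow> 'b::real_normed_field"
  shows "smooth_on UNIV f \<Longrightarrow> smooth_on UNIV (\<lambda>x. f x ^ n)"
  by (induction n) (auto intro: smooth_const smooth_mult)

lemma smooth_Pair:
  fixes f :: "'a::real_normed_vector \<Rightarrow> 'b::real_normed_vector"
    and g :: "'a \<Rightarrow> 'c::real_normed_vector"
  assumes "smooth_on UNIV f" "smooth_on UNIV g"
  shows "smooth_on UNIV (\<lambda>x. (f x, g x))"
proof -
  have l: "bounded_linear (\<lambda>y::'b. (y, 0::'c))" and r: "bounded_linear (\<lambda>y::'c. (0::'b, y))"
    by (simp_all add: bounded_linear_Pair bounded_linear_ident bounded_linear_zero)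
  show ?thesis
    using smooth_add[OF smooth_bounded_linear[OF l assms(1)] smooth_bounded_linear[OF r assms(2)]]
    by simp
qed

lemma bounded_linear_axis: "bounded_linear (axis j :: complex \<Rightarrow> complex ^ 'n::finite)"
  by (intro linear_conv_bounded_linear[THEN iffD1] linearI) (auto simp: axis_def vec_eq_iff)

lemma vec_eq_sum_axis:
  fixes f :: "'n::finite \<Rightarrow> complex"
  shows "(\<chi> j. f j) = (\<Sum>j\<in>UNIV. axis j (f j))"
  by (simp add: vec_eq_iff axis_def)

lemma smooth_vec:
  fixes f :: "'n::finite \<Rightarrow> _ \<Rightarrow> complex"
  assumes "\<And>j. smooth_on UNIV (f j)"
  shows "smooth_on UNIV (\<lambda>x. \<chi> j. f j x)"
  unfolding vec_eq_sum_axis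
  by (intro smooth_sum smooth_bounded_linear[OF bounded_linear_axis] assms)

lemma has_vector_derivative_vec:
  fixes f :: "'n::finite \<Rightarrow> real \<Rightarrow> complex"
  assumes "\<And>j. (f j has_vector_derivative f' j) (at t)"
  shows "((\<lambda>x. \<chi> j. f j x) has_vector_derivative (\<chi> j. f' j)) (at t)"
  unfolding vec_eq_sum_axis
  by (intro has_vector_derivative_sum
      bounded_linear.has_vector_derivative[OF bounded_linear_axis] assms)

text \<open>
Each function is, up to a constant, the derivative of the other, so the two are treated together.
\<close>

lemma smooth_cos_sin:
  fixes a :: real
  shows "smooth_on UNIV (\<lambda>t. cos (a * t))" and "smooth_on UNIV (\<lambda>t. sin (a * t))"
proof -
  have "Ck_on n UNIV (\<lambda>t. cos (a * t)) \<and> Ck_on n UNIV (\<lambda>t. sin (a * t))" for n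
  proof (induction n)
    case 0
    then show ?case by (auto intro!: continuous_intros)
  next
    case (Suc n)
    have c: "((\<lambda>t. cos (a * t)) has_derivative (\<lambda>v. (- a * v) * sin (a * x))) (at x)" for x
      by (auto intro!: derivative_eq_intros)
    have s: "((\<lambda>t. sin (a * t)) has_derivative (\<lambda>v. (a * v) * cos (a * x))) (at x)" for x
      by (auto intro!: derivative_eq_intros)
    show ?case
      using Suc
      by (auto intro!: Ck_on_SucI[OF c] Ck_on_SucI[OF s] Ck_on_bounded_linear[OF bounded_linear_mult_right]
          simp del: Ck_on.simps)
  qed
  then show "smooth_on UNIV (\<lambda>t. cos (a * t))" "smooth_on UNIV (\<lambda>t. sin (a * t))"
    by (auto simp: smooth_on_def)
qed

lemma smooth_cis: "smooth_on UNIV (\<lambda>t. cis (a * t))"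
proof -
  have "cis s = of_real (cos s) + \<i> * of_real (sin s)" for s
    by (simp add: complex_eq_iff)
  moreover have "smooth_on UNIV (\<lambda>t. of_real (cos (a * t)) + \<i> * of_real (sin (a * t)))"
    by (intro smooth_add smooth_mult smooth_const smooth_cos_sin
        smooth_bounded_linear[OF bounded_linear_of_real])
  ultimately show ?thesis by simp
qed

section \<open>Differentials along curves\<close>

text \<open>
  A derivative within \<open>X\<close> need not be unique, but its value at the velocity of a curve in \<open>X\<close> is the
  velocity of the image curve. All differentials below are computed through this fact.
\<close>

lemma has_vector_derivative_along_curve:
  assumes f: "(f has_derivative f') (at p within X)"
    and g: "range \<gamma> \<subseteq> X" "\<gamma> 0 = p" "(\<gamma> has_vector_derivative v) (at 0)"
  shows "((\<lambda>t. f (\<gamma> t)) has_vector_derivative f' v) (at 0)"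
proof -
  have "((\<lambda>t. f (\<gamma> t)) has_derivative (\<lambda>t. f' (t *\<^sub>R v))) (at 0)"
    by (rule has_derivative_in_compose[where f = \<gamma> and s = UNIV and g = f, simplified])
       (use g has_derivative_subset[OF f] in \<open>auto simp: has_vector_derivative_def\<close>)
  then show ?thesis
    unfolding has_vector_derivative_def
    by (simp add: linear_cmul[OF bounded_linear.linear[OF has_derivative_bounded_linear[OF f]]])
qed

lemma differential_along_curve:
  assumes "f differentiable (at p within X)"
    and "range \<gamma> \<subseteq> X" "\<gamma> 0 = p" "(\<gamma> has_vector_derivative v) (at 0)"
  shows "((\<lambda>t. f (\<gamma> t)) has_vector_derivative differential X f p v) (at 0)"
  unfolding differential_def
  by (rule has_vector_derivative_along_curve[OF _ assms(2-)])
     (use assms(1) frechet_derivative_works in blast)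

lemma differential_eq:
  assumes "(f has_derivative f') (at p)" "v \<in> tangent_space X p"
  shows "differential X f p v = f' v"
proof -
  obtain \<gamma> where g: "range \<gamma> \<subseteq> X" "\<gamma> 0 = p" "(\<gamma> has_vector_derivative v) (at 0)"
    using assms(2) by (auto simp: tangent_space_def)
  have w: "(f has_derivative f') (at p within X)"
    using assms(1) has_derivative_at_withinI by blast
  have "f differentiable (at p within X)"
    using w by (auto simp: differentiable_def)
  from differential_along_curve[OF this g] has_vector_derivative_along_curve[OF w g]
  show ?thesis by (rule vector_derivative_unique_at)
qed

lemma normal_component_props:
  assumes "subspace W"
  shows "\<forall>w\<in>W. orthogonal (normal_component W y) w" and "y - normal_component W y \<in> W"
proof -
  have sp: "span W = W" using assms by (simp add: span_eq_iff)
  obtain a b where ab: "a \<in> W" "\<And>w. w \<in> W \<Longrightarrow> orthogonal b w" "y = a + b"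
    by (rule orthogonal_subspace_decomp_exists[of W y, unfolded sp]) blast
  have "(\<forall>w\<in>W. orthogonal b w) \<and> y - b \<in> W"
    using ab by simp
  moreover have "n = b" if n: "(\<forall>w\<in>W. orthogonal n w) \<and> y - n \<in> W" for n
  proof -
    have "y - b \<in> W" using ab by simp
    then have "(y - b) - (y - n) \<in> W"
      using n subspace_diff[OF assms] by blast
    then have w: "n - b \<in> W" by simp
    have "n \<bullet> (n - b) = 0" "b \<bullet> (n - b) = 0"
      using n w ab(2)[OF w] by (auto simp: orthogonal_def)
    then have "(n - b) \<bullet> (n - b) = 0"
      by (simp only: inner_diff_left) 
    then show "n = b" by simp
  qed
  ultimately have "\<exists>!n. (\<forall>w\<in>W. orthogonal n w) \<and> y - n \<in> W"
    by (rule ex1I[of _ b])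
  note the = theI'[OF this, folded normal_component_def]
  show "\<forall>w\<in>W. orthogonal (normal_component W y) w" "y - normal_component W y \<in> W"
    by (rule conjunct1[OF the], rule conjunct2[OF the])
qed

section \<open>The tangent spaces of the product of a sphere and a torus\<close>

definition rotate_torus :: "real ^ 'n \<Rightarrow> real \<Rightarrow> complex ^ 'n \<Rightarrow> complex ^ 'n::finite" where
  "rotate_torus \<xi> t z = (\<chi> j. cis (\<xi> $ j * t) * z $ j)"

definition torus_velocity :: "real ^ 'n \<Rightarrow> complex ^ 'n \<Rightarrow> complex ^ 'n::finite" where
  "torus_velocity \<xi> z = (\<chi> j. \<i> * of_real (\<xi> $ j) * z $ j)"

text \<open>
For \<open>u = 0\<close> the quotient is \<open>0 / 0 = 0\<close> and the curve is constant, as it should be.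
\<close>

definition great_circle :: "'a::euclidean_space \<Rightarrow> 'a \<Rightarrow> real \<Rightarrow> 'a" where
  "great_circle x u t = cos (norm u * t) *\<^sub>R x + (sin (norm u * t) / norm u) *\<^sub>R u"

lemma rotate_torus_0 [simp]: "rotate_torus \<xi> 0 z = z"
  by (simp add: rotate_torus_def vec_eq_iff)

lemma rotate_torus_in: "z \<in> torus J \<Longrightarrow> rotate_torus \<xi> t z \<in> torus J"
  by (auto simp: torus_def rotate_torus_def norm_mult)

lemma great_circle_0 [simp]: "great_circle x u 0 = x"
  by (simp add: great_circle_def)

lemma great_circle_in_sphere:
  assumes "x \<in> sphere 0 1" "x \<bullet> u = 0"
  shows "great_circle x u t \<in> sphere 0 1"
proof (cases "u = 0")
  case False
  have "(norm (great_circle x u t))\<^sup>2 = (cos (norm u * t))\<^sup>2 * (x \<bullet> x)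
      + (sin (norm u * t) / norm u)\<^sup>2 * (u \<bullet> u)"
    using assms(2) unfolding power2_norm_eq_inner great_circle_def
    by (simp add: inner_add_left inner_add_right inner_commute power2_eq_square)
  also have "\<dots> = (cos (norm u * t))\<^sup>2 + (sin (norm u * t))\<^sup>2"
    using False assms(1) by (simp add: power2_norm_eq_inner[symmetric] power_divide)
  finally have "(norm (great_circle x u t))\<^sup>2 = 1\<^sup>2" by simp
  then have "norm (great_circle x u t) = 1"
    by (rule power2_eq_imp_eq) simp_all
  then show ?thesis by simp
qed (use assms in \<open>simp add: great_circle_def\<close>)

lemma has_vector_derivative_great_circle:
  "(great_circle x u has_vector_derivative u) (at 0)"
proof -
  have "((\<lambda>t. cos (norm u * t)) has_real_derivative - sin (norm u * 0) * norm u) (at 0)"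
    by (auto intro!: derivative_eq_intros)
  moreover have "((\<lambda>t. sin (norm u * t) / norm u) has_real_derivative
      cos (norm u * 0) * norm u / norm u) (at 0)"
    by (auto intro!: derivative_eq_intros)
  ultimately have "((\<lambda>t. cos (norm u * t) *\<^sub>R x + (sin (norm u * t) / norm u) *\<^sub>R u)
      has_vector_derivative (cos (norm u * 0) *\<^sub>R 0 + (- sin (norm u * 0) * norm u) *\<^sub>R x)
        + ((sin (norm u * 0) / norm u) *\<^sub>R 0 + (cos (norm u * 0) * norm u / norm u) *\<^sub>R u)) (at 0)"
    by (intro has_vector_derivative_add has_vector_derivative_scaleR has_vector_derivative_const)
  then show ?thesis by (cases "u = 0") (simp_all add: great_circle_def[abs_def])
qed

lemma smooth_great_circle: "smooth_on UNIV (great_circle x u)"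
proof -
  have b: "bounded_linear (\<lambda>s. s *\<^sub>R w)" for w :: 'a
    by (rule bounded_linear_scaleR_left)
  have "smooth_on UNIV (\<lambda>t. sin (norm u * t) * inverse (norm u))"
    by (intro smooth_mult smooth_const smooth_cos_sin)
  then show ?thesis
    unfolding great_circle_def[abs_def] divide_inverse
    by (intro smooth_add smooth_bounded_linear[OF b] smooth_cos_sin)
qed

lemma has_vector_derivative_cis:
  "((\<lambda>t. cis (a * t)) has_vector_derivative \<i> * of_real a) (at 0)"
proof -
  have "((\<lambda>t. \<i> * of_real a * of_real t) has_vector_derivative \<i> * of_real a * of_real 1) (at 0)"
    by (intro has_vector_derivative_mult_right has_vector_derivative_of_real) simp
  from field_vector_diff_chain_at[OF this DERIV_exp]
  show ?thesis by (simp add: cis_conv_exp o_def mult.assoc)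
qed

lemma has_vector_derivative_rotate_torus:
  "((\<lambda>t. rotate_torus \<xi> t z) has_vector_derivative torus_velocity \<xi> z) (at 0)"
  unfolding rotate_torus_def torus_velocity_def
  by (intro has_vector_derivative_vec has_vector_derivative_mult_left has_vector_derivative_cis)

lemma smooth_rotate_torus: "smooth_on UNIV (\<lambda>t. rotate_torus \<xi> t z)"
  unfolding rotate_torus_def
  by (intro smooth_vec smooth_mult smooth_cis smooth_const)

lemma tangent_spaceI:
  fixes x :: "'a::euclidean_space" and z :: "complex ^ 'n::finite" and \<xi> :: "real ^ 'n"
  assumes "x \<in> sphere 0 1" "z \<in> torus J" "x \<bullet> u = 0"
  defines "\<gamma> \<equiv> \<lambda>t. (great_circle x u t, rotate_torus \<xi> t z)"
  shows "range \<gamma> \<subseteq> sphere 0 1 \<times> torus J" and "\<gamma> 0 = (x, z)"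
    and "(\<gamma> has_vector_derivative (u, torus_velocity \<xi> z)) (at 0)"
    and "(u, torus_velocity \<xi> z) \<in> tangent_space (sphere 0 1 \<times> torus J) (x, z)"
proof -
  show r: "range \<gamma> \<subseteq> sphere 0 1 \<times> torus J"
    using great_circle_in_sphere[OF assms(1,3)] rotate_torus_in[OF assms(2)] by (auto simp: \<gamma>_def)
  show 0: "\<gamma> 0 = (x, z)"
    by (simp add: \<gamma>_def)
  show d: "(\<gamma> has_vector_derivative (u, torus_velocity \<xi> z)) (at 0)"
    unfolding \<gamma>_def
    by (intro has_vector_derivative_Pair has_vector_derivative_great_circle
        has_vector_derivative_rotate_torus)
  have "smooth_on UNIV \<gamma>"
    unfolding \<gamma>_def by (intro smooth_Pair smooth_great_circle smooth_rotate_torus)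
  then show "(u, torus_velocity \<xi> z) \<in> tangent_space (sphere 0 1 \<times> torus J) (x, z)"
    using r 0 d by (auto simp: tangent_space_def)
qed

text \<open>
Differentiating the constant \<open>\<gamma> \<bullet> \<gamma>\<close>.
\<close>

lemma unit_curve_inner_velocity:
  fixes \<gamma> :: "real \<Rightarrow> 'a::euclidean_space"
  assumes "\<And>t. norm (\<gamma> t) = 1" "(\<gamma> has_vector_derivative v) (at 0)"
  shows "\<gamma> 0 \<bullet> v = 0"
proof -
  have "((\<lambda>t. \<gamma> t \<bullet> \<gamma> t) has_vector_derivative \<gamma> 0 \<bullet> v + v \<bullet> \<gamma> 0) (at 0)"
    by (rule bounded_bilinear.has_vector_derivative[OF bounded_bilinear_inner assms(2) assms(2)])
  moreover have "(\<lambda>t. \<gamma> t \<bullet> \<gamma> t) = (\<lambda>t. 1)"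
    using assms(1) by (simp add: dot_square_norm)
  ultimately have "((\<lambda>t::real. 1::real) has_vector_derivative \<gamma> 0 \<bullet> v + v \<bullet> \<gamma> 0) (at 0)"
    by simp
  then have "\<gamma> 0 \<bullet> v + v \<bullet> \<gamma> 0 = 0"
    using vector_derivative_unique_at has_vector_derivative_const by blast
  then show ?thesis by (simp add: inner_commute)
qed

lemma unit_complex_orthogonal:
  assumes "norm (z::complex) = 1" "z \<bullet> w = 0"
  shows "w = \<i> * of_real (Im (w * cnj z)) * z"
proof -
  have "Re (w * cnj z) = 0"
    using assms(2) by (simp add: inner_complex_def mult.commute)
  then have "w * cnj z = \<i> * of_real (Im (w * cnj z))"
    by (simp add: complex_eq_iff)
  moreover have "w = w * cnj z * z"
    using assms(1) by (simp add: mult.assoc mult.commute[of "cnj z"] complex_norm_square[symmetric])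
  ultimately show ?thesis by metis
qed

text \<open>
  The components of \<open>\<xi>\<close> outside \<open>J\<close> have no influence on \<open>torus_velocity \<xi> z\<close>, since \<open>z\<close> vanishes
  there; hence one may let \<open>\<xi>\<close> range over a full vector type.
\<close>

lemma tangent_spaceE:
  fixes x :: "'a::euclidean_space" and z :: "complex ^ 'n::finite"
  assumes "\<tau> \<in> tangent_space (sphere 0 1 \<times> torus J) (x, z)"
  obtains u \<xi> where "\<tau> = (u, torus_velocity \<xi> z)" "x \<bullet> u = 0"
proof -
  obtain \<gamma> where g: "range \<gamma> \<subseteq> sphere 0 1 \<times> torus J" "\<gamma> 0 = (x, z)"
    "(\<gamma> has_vector_derivative \<tau>) (at 0)"
    using assms by (auto simp: tangent_space_def)
  have "\<gamma> t \<in> sphere 0 1 \<times> torus J" for t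
    using g(1) by blast
  then have in_t: "fst (\<gamma> t) \<in> sphere 0 1" "snd (\<gamma> t) \<in> torus J" for t
    by (simp_all add: mem_Times_iff)
  have "((\<lambda>t. fst (\<gamma> t)) has_vector_derivative fst \<tau>) (at 0)"
    by (rule bounded_linear.has_vector_derivative[OF bounded_linear_fst g(3)])
  then have u: "x \<bullet> fst \<tau> = 0"
    using unit_curve_inner_velocity[of "\<lambda>t. fst (\<gamma> t)"] in_t g(2) by simp
  have s: "((\<lambda>t. snd (\<gamma> t)) has_vector_derivative snd \<tau>) (at 0)"
    by (rule bounded_linear.has_vector_derivative[OF bounded_linear_snd g(3)])
  have c: "((\<lambda>t. snd (\<gamma> t) $ j) has_vector_derivative snd \<tau> $ j) (at 0)" for j
    by (rule bounded_linear.has_vector_derivative[OF bounded_linear_vec_nth s])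
  define \<xi> where "\<xi> = (\<chi> j. Im (snd \<tau> $ j * cnj (z $ j)))"
  have "snd \<tau> $ j = \<i> * of_real (\<xi> $ j) * z $ j" for j
  proof (cases "j \<in> J")
    case True
    have n: "norm (snd (\<gamma> t) $ j) = 1" for t
      using in_t(2)[of t] True by (auto simp: torus_def)
    have "z $ j \<bullet> snd \<tau> $ j = 0"
      using unit_curve_inner_velocity[OF n c] g(2) by simp
    then show ?thesis
      using unit_complex_orthogonal[of "z $ j"] n[of 0] g(2) by (simp add: \<xi>_def)
  next
    case False
    then have "(\<lambda>t. snd (\<gamma> t) $ j) = (\<lambda>t. 0)"
      using in_t(2) by (auto simp: torus_def)
    then have "((\<lambda>t::real. 0) has_vector_derivative snd \<tau> $ j) (at 0)" "z $ j = 0"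
      using c[of j] g(2) by (auto dest: fun_cong[of _ _ 0])
    then show ?thesis
      using vector_derivative_unique_at[OF _ has_vector_derivative_const] by auto
  qed
  then have "snd \<tau> = torus_velocity \<xi> z"
    by (simp add: vec_eq_iff torus_velocity_def)
  with u show thesis
    by (intro that[of "fst \<tau>" \<xi>]) (auto simp: prod_eq_iff)
qed

lemma tangent_space_sphere_torus:
  fixes x :: "'a::euclidean_space" and z :: "complex ^ 'n::finite"
  assumes "x \<in> sphere 0 1" "z \<in> torus J"
  shows "tangent_space (sphere 0 1 \<times> torus J) (x, z) =
    {(u, torus_velocity \<xi> z) |u \<xi>. x \<bullet> u = 0}"
  using tangent_spaceI(4)[OF assms] tangent_spaceE[of _ J x z] by blast

lemma linear_torus_velocity: "linear (\<lambda>\<xi>. torus_velocity \<xi> z)"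
  by (rule linearI) (auto simp: torus_velocity_def vec_eq_iff algebra_simps
      scaleR_conv_of_real[where 'a = complex])

lemma subspace_tangent_space:
  assumes "x \<in> sphere 0 1" "z \<in> torus J"
  shows "subspace (tangent_space (sphere 0 1 \<times> torus J) (x, z))"
  unfolding tangent_space_sphere_torus[OF assms]
proof (rule subspaceI, goal_cases)
  case 1
  show ?case
    using linear_0[OF linear_torus_velocity, of z] by (auto simp: zero_prod_def intro!: exI[of _ 0])
next
  case (2 v w)
  then show ?case
    by (force simp: inner_add_right linear_add[OF linear_torus_velocity, symmetric])
next
  case (3 c v)
  then show ?case
    by (force simp: linear_cmul[OF linear_torus_velocity, symmetric])
qed

text \<open>
  The second fundamental form refers to a tangent field selected by a choice operator. A witness is
  the projection of a constant field on the sphere factor together with the infinitesimal rotation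
  \<open>\<xi>\<close> on the torus factor; it is polynomial, hence globally smooth.
\<close>

lemma tangent_field_exists:
  assumes xz: "x \<in> sphere 0 1" "z \<in> torus J"
    and \<tau>: "\<tau> \<in> tangent_space (sphere 0 1 \<times> torus J) (x, z)"
  shows "\<exists>V. tangent_field (sphere 0 1 \<times> torus J) V \<and> V (x, z) = \<tau>"
proof -
  obtain u \<xi> where t: "\<tau> = (u, torus_velocity \<xi> z)" "x \<bullet> u = 0"
    using \<tau> by (rule tangent_spaceE)
  define V where "V = (\<lambda>q. (u + (-(u \<bullet> fst q)) *\<^sub>R fst q, torus_velocity \<xi> (snd q)))"
  have f: "smooth_on UNIV (fst :: 'a \<times> (complex ^ 'b) \<Rightarrow> 'a)"
    and s: "smooth_on UNIV (snd :: 'a \<times> (complex ^ 'b) \<Rightarrow> complex ^ 'b)"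
    by (intro smooth_linear bounded_linear_fst bounded_linear_snd)+
  have "bounded_linear (\<lambda>y. - (u \<bullet> y))"
    by (intro bounded_linear_minus bounded_linear_inner_right)
  from smooth_bounded_linear[OF this f]
  have "smooth_on UNIV V"
    unfolding V_def torus_velocity_def
    by (intro smooth_Pair smooth_add smooth_const smooth_bilinear[OF bounded_bilinear_scaleR] f
        smooth_vec smooth_mult smooth_bounded_linear[OF bounded_linear_vec_nth] s)
  then have "smooth_map (sphere 0 1 \<times> torus J) V"
    unfolding smooth_map_def by blast
  moreover have "V q \<in> tangent_space (sphere 0 1 \<times> torus J) q" if "q \<in> sphere 0 1 \<times> torus J" for q
  proof -
    obtain y w where q: "q = (y, w)" by fastforce
    have yw: "y \<in> sphere 0 1" "w \<in> torus J" using that q by auto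
    have "y \<bullet> (u + (- (u \<bullet> y)) *\<^sub>R y) = 0"
      using yw by (simp add: inner_diff_right inner_commute dot_square_norm)
    then show ?thesis
      unfolding q V_def tangent_space_sphere_torus[OF yw] by auto
  qed
  moreover have "V (x, z) = \<tau>"
    using t by (simp add: V_def inner_commute)
  ultimately show ?thesis
    by (auto simp: tangent_field_def)
qed

section \<open>Tubes around torus orbits\<close>

text \<open>
  \<open>U\<close> is a smooth family of linear maps that is orthogonal on the torus, \<open>A\<close> gives its infinitesimal
  generators, and the orbit of \<open>v0\<close> is an immersed torus whose acceleration along any one-parameter
  subgroup is at most \<open>c\<close> times the squared speed. \<open>L\<close> is an isometry onto the normal space of the
  orbit at \<open>v0\<close>, so \<open>U z \<circ> L\<close> is a global frame of the normal bundle.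
\<close>

locale torus_orbit =
  fixes J :: "'n::finite set"
    and U :: "complex ^ 'n \<Rightarrow> 'b::euclidean_space \<Rightarrow> 'b"
    and A :: "real ^ 'n \<Rightarrow> 'b \<Rightarrow> 'b"
    and v0 :: 'b
    and L :: "'a::euclidean_space \<Rightarrow> 'b"
    and c :: real
  assumes linear_U: "linear (U z)"
    and smooth_U: "smooth_on UNIV (\<lambda>z. U z y)"
    and inner_U: "z \<in> torus J \<Longrightarrow> U z y \<bullet> U z y' = y \<bullet> y'"
    and deriv_U: "z \<in> torus J \<Longrightarrow>
      ((\<lambda>t. U (rotate_torus \<xi> t z) y) has_vector_derivative U z (A \<xi> y)) (at 0)"
    and linear_A: "linear (A \<xi>)"
    and linear_A_left: "linear (\<lambda>\<xi>. A \<xi> y)"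
    and skew_A: "A \<xi> y \<bullet> y' = - (y \<bullet> A \<xi> y')"
    and norm_v0: "norm v0 \<le> 1"
    and c_nonneg: "0 \<le> c"
    and orbit_curvature: "norm (A \<xi> (A \<xi> v0)) \<le> c * (norm (A \<xi> v0))\<^sup>2"
    and A_v0_eq_0: "A \<xi> v0 = 0 \<Longrightarrow> j \<in> J \<Longrightarrow> \<xi> $ j = 0"
    and A_eq_0: "(\<And>j. j \<in> J \<Longrightarrow> \<xi> $ j = 0) \<Longrightarrow> A \<xi> y = 0"
    and linear_L: "linear L"
    and norm_L: "norm (L x) = norm x"
    and range_L: "range L = {y. \<forall>\<xi>. y \<bullet> A \<xi> v0 = 0}"
begin

text \<open>
  On the tube of radius \<open>s\<close> around a core of curvature \<open>c / r\<close> the principal curvatures are \<open>1 / s\<close>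
  in the fibres and at most \<open>c / (r - c * s)\<close> along the core. With \<open>r + s = 1\<close>, which keeps the
  tube in the unit ball, both equal \<open>1 + 2 * c\<close> for the values chosen here.
\<close>

definition "radius = 1 / (1 + 2 * c)"

definition "core_scale = 2 * c * radius"

abbreviation "X \<equiv> (sphere 0 1 :: 'a set) \<times> torus J"

definition tube :: "'a \<times> (complex ^ 'n) \<Rightarrow> 'b" where
  "tube q = U (snd q) (core_scale *\<^sub>R v0 + radius *\<^sub>R L (fst q))"

definition tube_normal :: "'a \<times> (complex ^ 'n) \<Rightarrow> 'b" where
  "tube_normal q = U (snd q) (L (fst q))"

lemma radius_pos: "0 < radius"
  using c_nonneg by (simp add: radius_def)

lemma core_scale_nonneg: "0 \<le> core_scale"
  using c_nonneg radius_pos by (simp add: core_scale_def)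

lemma core_scale_plus_radius: "core_scale + radius = 1"
  using c_nonneg by (simp add: core_scale_def radius_def field_simps)

lemma inner_L: "L x \<bullet> L y = x \<bullet> y"
  by (simp add: dot_norm linear_add[OF linear_L, symmetric] norm_L)

lemma L_orthogonal: "L x \<bullet> A \<xi> v0 = 0"
  using range_L by blast

lemma A_inner_self: "A \<xi> y \<bullet> y = 0"
  using skew_A[of \<xi> y y] by (simp add: inner_commute)

lemma norm_U: "z \<in> torus J \<Longrightarrow> norm (U z y) = norm y"
  using inner_U[of z y y] by (simp add: norm_eq_sqrt_inner)

lemma U_expand: "U z y = (\<Sum>b\<in>Basis. (y \<bullet> b) *\<^sub>R U z b)"
proof -
  have "U z y = U z (\<Sum>b\<in>Basis. (y \<bullet> b) *\<^sub>R b)" by (simp only: euclidean_representation)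
  also have "\<dots> = (\<Sum>b\<in>Basis. (y \<bullet> b) *\<^sub>R U z b)"
    by (simp only: linear_sum[OF linear_U] linear_cmul[OF linear_U])
  finally show ?thesis .
qed

text \<open>
Linearity in \<open>y\<close> turns smoothness of every orbit map into joint smoothness.
\<close>

lemma smooth_act:
  fixes Y :: "'a \<times> (complex ^ 'n) \<Rightarrow> 'b"
  assumes "smooth_on UNIV Y"
  shows "smooth_on UNIV (\<lambda>q. U (snd q) (Y q))"
proof -
  have eq: "(\<lambda>q. U (snd q) (Y q)) = (\<lambda>q. \<Sum>b\<in>Basis. (Y q \<bullet> b) *\<^sub>R U (snd q) b)"
    by (rule ext) (rule U_expand)
  show ?thesis
    unfolding eq
    by (intro smooth_sum smooth_bilinear[OF bounded_bilinear_scaleR]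
        smooth_bounded_linear[OF bounded_linear_inner_left] assms
        smooth_compose_linear[OF bounded_linear_snd smooth_U])
qed

lemma smooth_tube: "smooth_on UNIV tube" and smooth_tube_normal: "smooth_on UNIV tube_normal"
proof -
  have "bounded_linear (\<lambda>q :: 'a \<times> (complex ^ 'n). L (fst q))"
    using linear_L by (intro bounded_linear_compose[OF _ bounded_linear_fst])
      (simp add: linear_conv_bounded_linear)
  note L = smooth_linear[OF this]
  show "smooth_on UNIV tube"
    unfolding tube_def[abs_def]
    by (intro smooth_act smooth_add smooth_const L smooth_bounded_linear[OF bounded_linear_scaleR_right])
  show "smooth_on UNIV tube_normal"
    unfolding tube_normal_def[abs_def]
    by (intro smooth_act L)
qed

lemma act_along_curve:
  assumes "z \<in> torus J" "(y has_vector_derivative y') (at 0)"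
  shows "((\<lambda>t. U (rotate_torus \<xi> t z) (y t)) has_vector_derivative U z (A \<xi> (y 0) + y')) (at 0)"
proof -
  have eq: "(\<lambda>t. U (rotate_torus \<xi> t z) (y t))
      = (\<lambda>t. \<Sum>b\<in>Basis. (y t \<bullet> b) *\<^sub>R U (rotate_torus \<xi> t z) b)"
    by (rule ext) (rule U_expand)
  have "U z (A \<xi> (y 0)) = U z (A \<xi> (\<Sum>b\<in>Basis. (y 0 \<bullet> b) *\<^sub>R b))"
    by (simp only: euclidean_representation)
  also have "\<dots> = (\<Sum>b\<in>Basis. (y 0 \<bullet> b) *\<^sub>R U z (A \<xi> b))"
    by (simp only: linear_sum[OF linear_A] linear_cmul[OF linear_A] linear_sum[OF linear_U]
        linear_cmul[OF linear_U])
  finally have "U z (A \<xi> (y 0) + y') =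
      (\<Sum>b\<in>Basis. (y 0 \<bullet> b) *\<^sub>R U z (A \<xi> b)) + (\<Sum>b\<in>Basis. (y' \<bullet> b) *\<^sub>R U z b)"
    using U_expand[of z y'] by (simp only: linear_add[OF linear_U])
  also have "\<dots> = (\<Sum>b\<in>Basis. (y 0 \<bullet> b) *\<^sub>R U z (A \<xi> b)
      + (y' \<bullet> b) *\<^sub>R U (rotate_torus \<xi> 0 z) b)"
    by (simp only: sum.distrib rotate_torus_0)
  finally have eq': "U z (A \<xi> (y 0) + y') = \<dots>" .
  show ?thesis
    unfolding eq eq'
    by (intro has_vector_derivative_sum
        bounded_bilinear.has_vector_derivative[OF bounded_bilinear_scaleR]
        bounded_linear.has_vector_derivative[OF bounded_linear_inner_left] assms(2) deriv_U assms(1))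
qed

lemma linear_along_great_circle:
  "((\<lambda>t. y + k *\<^sub>R L (great_circle x u t)) has_vector_derivative k *\<^sub>R L u) (at 0)"
proof -
  have "bounded_linear (\<lambda>x. k *\<^sub>R L x)"
    using linear_L by (intro bounded_linear_const_scaleR) (simp add: linear_conv_bounded_linear)
  from bounded_linear.has_vector_derivative[OF this has_vector_derivative_great_circle]
  have "((\<lambda>t. y + k *\<^sub>R L (great_circle x u t)) has_vector_derivative 0 + k *\<^sub>R L u) (at 0)"
    by (intro has_vector_derivative_add has_vector_derivative_const)
  then show ?thesis by simp
qed

text \<open>
  The velocity of \<open>tube\<close>, moved back by \<open>U z\<close>. Moved back in the same way, the velocity of \<open>tube_normal\<close> is
  \<open>A \<xi> (L x) + L u\<close>, the second summand divided by \<open>radius\<close>.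
\<close>

definition tube_velocity :: "'a \<Rightarrow> 'a \<Rightarrow> real ^ 'n \<Rightarrow> 'b" where
  "tube_velocity x u \<xi> = core_scale *\<^sub>R A \<xi> v0 + radius *\<^sub>R (A \<xi> (L x) + L u)"

lemma tube_along_curve:
  assumes "z \<in> torus J"
  shows "((\<lambda>t. tube (great_circle x u t, rotate_torus \<xi> t z)) has_vector_derivative
    U z (tube_velocity x u \<xi>)) (at 0)"
  using act_along_curve[OF assms linear_along_great_circle[of "core_scale *\<^sub>R v0" radius x u], of \<xi>]
  by (simp add: tube_def tube_velocity_def linear_add[OF linear_A] linear_cmul[OF linear_A]
      scaleR_add_right add.assoc)

lemma tube_normal_along_curve:
  assumes "z \<in> torus J"
  shows "((\<lambda>t. tube_normal (great_circle x u t, rotate_torus \<xi> t z)) has_vector_derivative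
    U z (A \<xi> (L x) + L u)) (at 0)"
  using act_along_curve[OF assms linear_along_great_circle[of 0 1 x u], of \<xi>]
  by (simp add: tube_normal_def)

lemma differential_tube_eq_frechet:
  assumes "\<tau> \<in> tangent_space X q"
  shows "differential X tube q \<tau> = frechet_derivative tube (at q) \<tau>"
  by (rule differential_eq[OF smooth_on_imp_has_derivative[OF smooth_tube] assms]) simp

lemma differential_tube:
  assumes "x \<in> sphere 0 1" "z \<in> torus J" "x \<bullet> u = 0"
  shows "differential X tube (x, z) (u, torus_velocity \<xi> z) = U z (tube_velocity x u \<xi>)"
proof -
  note c = tangent_spaceI[OF assms, of \<xi>]
  have "tube differentiable (at (x, z) within X)"
    using smooth_on_imp_differentiable(1)[OF smooth_tube] differentiable_at_withinI by blast
  from differential_along_curve[OF this c(1-3)] tube_along_curve[OF assms(2)]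
  show ?thesis by (rule vector_derivative_unique_at)
qed

text \<open>
  The tube does not reach the focal set: skewness gives \<open>A \<xi> (L x) \<bullet> A \<xi> v0 = - (L x \<bullet> A \<xi> (A \<xi> v0))\<close>,
  which the curvature bound of the orbit controls, and \<open>core_scale - c * radius = c * radius\<close>.
\<close>

lemma velocity_inner_orbit:
  assumes "x \<in> sphere 0 1"
  shows "tube_velocity x u \<xi> \<bullet> A \<xi> v0 \<ge> radius * c * (norm (A \<xi> v0))\<^sup>2"
proof -
  let ?a = "A \<xi> v0"
  have "L x \<bullet> A \<xi> ?a \<le> norm (L x) * norm (A \<xi> ?a)"
    by (rule norm_cauchy_schwarz)
  also have "\<dots> \<le> c * (norm ?a)\<^sup>2"
    using assms orbit_curvature by (simp add: norm_L)
  finally have "- (c * (norm ?a)\<^sup>2) \<le> (A \<xi> (L x) + L u) \<bullet> ?a"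
    by (simp add: skew_A[of \<xi> "L x"] inner_add_left L_orthogonal)
  then have "radius * - (c * (norm ?a)\<^sup>2) \<le> radius * ((A \<xi> (L x) + L u) \<bullet> ?a)"
    using radius_pos by (intro mult_left_mono) auto
  moreover have "(core_scale *\<^sub>R a + radius *\<^sub>R b) \<bullet> a = core_scale * (norm a)\<^sup>2 + radius * (b \<bullet> a)"
    for a b :: 'b
    by (simp add: inner_add_left dot_square_norm)
  moreover have "radius * (c * (norm ?a)\<^sup>2) + radius * c * (norm ?a)\<^sup>2 = core_scale * (norm ?a)\<^sup>2"
    by (simp add: core_scale_def)
  ultimately show ?thesis
    unfolding tube_velocity_def by (simp only: mult_minus_right)
qed

lemma A_v0_eq_0_if_orthogonal:
  assumes "x \<in> sphere 0 1" "tube_velocity x u \<xi> \<bullet> A \<xi> v0 = 0"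
  shows "A \<xi> v0 = 0"
\<comment> \<open>If the curvature bound of the orbit is 0, the orbit is a point: by skewness, the square of a generator vanishes at v0 only if the generator does.\<close>
proof (cases "c = 0")
  case True
  then have "A \<xi> (A \<xi> v0) = 0" using orbit_curvature[of \<xi>] by simp
  then have "A \<xi> v0 \<bullet> A \<xi> v0 = 0" using skew_A[of \<xi> v0 "A \<xi> v0"] by simp
  then show ?thesis by simp
next
  case False
  then have "0 < radius * c" using c_nonneg radius_pos by simp
  moreover have "radius * c * (norm (A \<xi> v0))\<^sup>2 \<le> 0"
    using velocity_inner_orbit[OF assms(1), of \<xi> u] assms(2) by simp
  ultimately have "(norm (A \<xi> v0))\<^sup>2 \<le> 0"
    using mult_pos_pos[of "radius * c" "(norm (A \<xi> v0))\<^sup>2"] by linarith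
  then show ?thesis by simp
qed

lemma tube_velocity_eq_0:
  assumes "x \<in> sphere 0 1" "tube_velocity x u \<xi> = 0"
  shows "u = 0" and "j \<in> J \<Longrightarrow> \<xi> $ j = 0"
proof -
  have 0: "A \<xi> v0 = 0"
    using A_v0_eq_0_if_orthogonal[OF assms(1), of u \<xi>] assms(2) by simp
  show *: "\<xi> $ j = 0" if "j \<in> J" for j using A_v0_eq_0[OF 0 that] .
  then have "A \<xi> y = 0" for y using A_eq_0 by blast
  then have "L u = 0"
    using assms(2) radius_pos by (simp add: tube_velocity_def)
  then show "u = 0" using norm_L[of u] by simp
qed

lemma tube_velocity_diff:
  "tube_velocity x u \<xi> - tube_velocity x u' \<xi>' = tube_velocity x (u - u') (\<xi> - \<xi>')"
  by (simp add: tube_velocity_def linear_diff[OF linear_A_left] linear_diff[OF linear_L] algebra_simps)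

lemma immersion_tube: "immersion_on X tube"
  unfolding immersion_on_def
proof (intro conjI ballI)
  show "smooth_map X tube"
    using smooth_tube unfolding smooth_map_def by blast
  fix p assume "p \<in> X"
  then obtain x z where p: "p = (x, z)" "x \<in> sphere 0 1" "z \<in> torus J" by blast
  show "inj_on (differential X tube p) (tangent_space X p)"
  proof (rule inj_onI)
    fix \<tau> \<tau>' assume t: "\<tau> \<in> tangent_space X p" "\<tau>' \<in> tangent_space X p"
      and eq: "differential X tube p \<tau> = differential X tube p \<tau>'"
    obtain u \<xi> where 1: "\<tau> = (u, torus_velocity \<xi> z)" "x \<bullet> u = 0"
      using t(1) unfolding p(1) by (rule tangent_spaceE)
    obtain u' \<xi>' where 2: "\<tau>' = (u', torus_velocity \<xi>' z)" "x \<bullet> u' = 0"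
      using t(2) unfolding p(1) by (rule tangent_spaceE)
    have "U z (tube_velocity x u \<xi>) = U z (tube_velocity x u' \<xi>')"
      using eq unfolding p(1) 1(1) 2(1)
      by (simp add: differential_tube[OF p(2,3) 1(2)] differential_tube[OF p(2,3) 2(2)])
    then have "U z (tube_velocity x (u - u') (\<xi> - \<xi>')) = 0"
      by (simp add: linear_diff[OF linear_U] flip: tube_velocity_diff)
    then have "tube_velocity x (u - u') (\<xi> - \<xi>') = 0"
      using norm_U[OF p(3)] by (metis norm_eq_zero)
    note 0 = tube_velocity_eq_0[OF p(2) this]
    have "\<xi> $ j * z $ j = \<xi>' $ j * z $ j" for j
      using 0(2)[of j] p(3) by (cases "j \<in> J") (auto simp: torus_def)
    then have "torus_velocity \<xi> z = torus_velocity \<xi>' z"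
      by (simp add: torus_velocity_def vec_eq_iff mult.assoc)
    then show "\<tau> = \<tau>'" using 1(1) 2(1) 0(1) by simp
  qed
qed

lemma tube_in_ball: "tube ` X \<subseteq> cball 0 1"
proof -
  have "norm (tube (x, z)) \<le> 1" if "x \<in> sphere 0 1" "z \<in> torus J" for x z
  proof -
    have "norm (tube (x, z)) \<le> core_scale * norm v0 + radius * norm (L x)"
      using norm_triangle_ineq[of "core_scale *\<^sub>R v0" "radius *\<^sub>R L x"] core_scale_nonneg radius_pos
      by (simp add: tube_def norm_U[OF that(2)])
    also have "\<dots> \<le> core_scale * 1 + radius * 1"
      using that(1) norm_v0 core_scale_nonneg radius_pos
      by (intro add_mono mult_left_mono) (auto simp: norm_L)
    finally show ?thesis using core_scale_plus_radius by simp
  qed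
  then show ?thesis by auto
qed

lemma tube_velocity_inner_L:
  assumes "x \<bullet> u = 0"
  shows "tube_velocity x u \<xi> \<bullet> L x = 0"
proof -
  have "A \<xi> v0 \<bullet> L x = 0" "u \<bullet> x = 0"
    using assms L_orthogonal[of x \<xi>] by (simp_all add: inner_commute)
  then show ?thesis
    by (simp add: tube_velocity_def inner_add_left A_inner_self inner_L)
qed

lemma differential_tube_inner_normal:
  assumes "q \<in> X" "\<tau> \<in> tangent_space X q"
  shows "differential X tube q \<tau> \<bullet> tube_normal q = 0"
proof -
  obtain x z where q: "q = (x, z)" "x \<in> sphere 0 1" "z \<in> torus J" using assms(1) by blast
  obtain u \<xi> where t: "\<tau> = (u, torus_velocity \<xi> z)" "x \<bullet> u = 0"
    using assms(2) unfolding q(1) by (rule tangent_spaceE)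
  show ?thesis
    unfolding q(1) t(1) differential_tube[OF q(2,3) t(2)]
    by (simp add: tube_normal_def inner_U[OF q(3)] tube_velocity_inner_L[OF t(2)])
qed

lemma orbit_decomposition: "\<exists>\<eta> b. y = A \<eta> v0 + L b"
proof -
  have sub: "span (range (\<lambda>\<xi>. A \<xi> v0)) = range (\<lambda>\<xi>. A \<xi> v0)"
    using linear_subspace_image[OF linear_A_left subspace_UNIV] by (simp add: span_eq_iff)
  obtain w n where w: "w \<in> range (\<lambda>\<xi>. A \<xi> v0)"
    "\<And>w. w \<in> range (\<lambda>\<xi>. A \<xi> v0) \<Longrightarrow> orthogonal n w" "y = w + n"
    by (rule orthogonal_subspace_decomp_exists[of "range (\<lambda>\<xi>. A \<xi> v0)" y, unfolded sub]) blast
  from w(2) have "n \<in> range L"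
    unfolding range_L by (auto simp: orthogonal_def)
  with w show ?thesis by blast
qed

text \<open>
  The normal line is determined without counting dimensions: split a normal vector into a part
  tangent to the orbit and a part in the range of \<open>L\<close>. Testing against fibre directions leaves a
  multiple of \<open>L x\<close> in the second part; testing against the torus direction given by the first part
  itself shows that this first part vanishes.
\<close>

lemma orthogonal_to_tube:
  assumes p: "x \<in> sphere 0 1" "z \<in> torus J"
    and n: "\<And>w. w \<in> differential X tube (x, z) ` tangent_space X (x, z) \<Longrightarrow> n \<bullet> w = 0"
  shows "\<exists>\<beta>. n = \<beta> *\<^sub>R tube_normal (x, z)"
proof -
  have "inj (U z)"
    unfolding linear_injective_0[OF linear_U] using norm_U[OF p(2)] by (metis norm_eq_zero)
  then have "surj (U z)" by (rule linear_injective_imp_surjective[OF linear_U _ refl])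
  then obtain y where y: "n = U z y" by blast
  obtain \<eta> b where d: "y = A \<eta> v0 + L b" using orbit_decomposition by blast
  have orth: "y \<bullet> tube_velocity x u \<xi> = 0" if "x \<bullet> u = 0" for u \<xi>
  proof -
    have "U z (tube_velocity x u \<xi>) \<in> differential X tube (x, z) ` tangent_space X (x, z)"
      unfolding differential_tube[OF p that, symmetric]
      by (rule imageI[OF tangent_spaceI(4)[OF p that]])
    from n[OF this] show ?thesis by (simp add: y inner_U[OF p(2)])
  qed
  define u where "u = b - (b \<bullet> x) *\<^sub>R x"
  have xu: "x \<bullet> u = 0"
    using p(1) by (simp add: u_def inner_diff_right dot_square_norm inner_commute)
  have A0: "A 0 y' = 0" for y' by (rule A_eq_0) simp
  have "A \<eta> v0 \<bullet> L u = 0"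
    using L_orthogonal[of u \<eta>] by (simp add: inner_commute)
  then have "b \<bullet> u = 0"
    using orth[OF xu, of 0] radius_pos
    by (simp add: tube_velocity_def A0 d inner_add_left inner_L)
  moreover have "u \<bullet> u = b \<bullet> u - (b \<bullet> x) * (x \<bullet> u)"
    by (subst (1) u_def) (simp add: inner_diff_left)
  ultimately have "u \<bullet> u = 0"
    using xu by simp
  then have b: "b = (b \<bullet> x) *\<^sub>R x" by (simp add: u_def)
  have Lb: "L b = (b \<bullet> x) *\<^sub>R L x"
    by (subst b) (rule linear_cmul[OF linear_L])
  have "tube_velocity x 0 \<eta> \<bullet> A \<eta> v0 = 0"
    using orth[of 0 \<eta>] tube_velocity_inner_L[of x 0 \<eta>]
    by (simp add: d inner_add_right Lb inner_commute[of "A \<eta> v0 + _"])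
  then have "A \<eta> v0 = 0" by (rule A_v0_eq_0_if_orthogonal[OF p(1)])
  then have "n = (b \<bullet> x) *\<^sub>R tube_normal (x, z)"
    by (simp add: y d Lb tube_normal_def linear_cmul[OF linear_U])
  then show ?thesis by blast
qed

text \<open>
  With \<open>a = A \<xi> v0\<close>, the velocities \<open>P\<close> of the tube and \<open>b\<close> of its normal satisfy
  \<open>P = core_scale * a + radius * b\<close>, so \<open>radius * (P \<bullet> b) = P \<bullet> P - core_scale * (P \<bullet> a)\<close>.
  The lower bound on \<open>P \<bullet> a\<close> and the Cauchy-Schwarz inequality place the subtracted term between \<open>0\<close> and \<open>2 * (P \<bullet> P)\<close>.
\<close>

lemma shape_operator_bound:
  assumes "x \<in> sphere 0 1"
  shows "\<bar>tube_velocity x u \<xi> \<bullet> (A \<xi> (L x) + L u)\<bar>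
    \<le> (1 + 2 * c) * (norm (tube_velocity x u \<xi>))\<^sup>2"
proof -
  define P where "P = tube_velocity x u \<xi>"
  define a where "a = A \<xi> v0"
  define b where "b = A \<xi> (L x) + L u"
  have P: "P = core_scale *\<^sub>R a + radius *\<^sub>R b"
    by (simp add: P_def a_def b_def tube_velocity_def)
  have ge: "P \<bullet> a \<ge> radius * c * (norm a)\<^sup>2"
    unfolding P_def a_def by (rule velocity_inner_orbit[OF assms])
  have ge0: "0 \<le> P \<bullet> a"
    by (rule order_trans[OF _ ge]) (use radius_pos c_nonneg in simp)
  have Pa: "P \<bullet> a \<le> norm P * norm a" by (rule norm_cauchy_schwarz)
  have "core_scale * (norm a)\<^sup>2 \<le> 2 * (P \<bullet> a)"
    using ge by (simp add: core_scale_def algebra_simps)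
  then have "(core_scale * norm a) * norm a \<le> (2 * norm P) * norm a"
    using Pa by (simp add: power2_eq_square mult.assoc)
  then have "core_scale * norm a \<le> 2 * norm P"
    by (cases "a = 0") auto
  then have "norm P * (core_scale * norm a) \<le> norm P * (2 * norm P)"
    by (intro mult_left_mono) auto
  moreover have "core_scale * (P \<bullet> a) \<le> core_scale * (norm P * norm a)"
    using Pa core_scale_nonneg by (intro mult_left_mono)
  ultimately have up: "core_scale * (P \<bullet> a) \<le> 2 * (norm P)\<^sup>2"
    by (simp add: power2_eq_square algebra_simps)
  have "(norm P)\<^sup>2 = P \<bullet> P" by (simp add: dot_square_norm)
  also have "P \<bullet> P = P \<bullet> (core_scale *\<^sub>R a + radius *\<^sub>R b)" using P by simp
  finally have "radius * (P \<bullet> b) = (norm P)\<^sup>2 - core_scale * (P \<bullet> a)"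
    by (simp add: inner_add_right)
  then have "\<bar>radius * (P \<bullet> b)\<bar> \<le> (norm P)\<^sup>2"
    using up mult_nonneg_nonneg[OF core_scale_nonneg ge0] by linarith
  then have "\<bar>P \<bullet> b\<bar> * radius \<le> (norm P)\<^sup>2"
    using radius_pos by (simp add: abs_mult mult.commute)
  then show ?thesis
    using c_nonneg unfolding P_def b_def radius_def by (simp add: field_simps)
qed

text \<open>
  On \<open>X\<close> the differential agrees with the Frechet derivative of the globally smooth map, and near \<open>p\<close>
  the field \<open>V\<close> has a smooth extension; in coordinates the product of the two is differentiable.
\<close>

lemma field_derivative_differentiable:
  assumes V: "tangent_field X V" and p: "p \<in> X"
  shows "(\<lambda>q. differential X tube q (V q)) differentiable (at p within X)"
proof -
  obtain W g where W: "open W" "p \<in> W" "smooth_on W g" "\<forall>q\<in>X \<inter> W. g q = V q"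
    using V p unfolding tangent_field_def smooth_map_def by blast
  define G where "G = (\<lambda>q. \<Sum>b\<in>Basis. (g q \<bullet> b) *\<^sub>R frechet_derivative tube (at q) b)"
  have "g differentiable (at p)"
    using smooth_on_imp_differentiable(1)[OF W(3,2)] .
  then have "(\<lambda>q. g q \<bullet> b) differentiable (at p)" for b
    by (auto simp: differentiable_def intro: has_derivative_inner_left)
  moreover have "(\<lambda>q. frechet_derivative tube (at q) b) differentiable (at p)" for b
    by (rule smooth_on_imp_differentiable(2)[OF smooth_tube UNIV_I])
  ultimately have "G differentiable (at p)"
    unfolding G_def by (intro differentiable_sum finite_Basis ballI differentiable_scaleR) auto
  then obtain G' where G': "(G has_derivative G') (at p within X)"
    using differentiable_at_withinI unfolding differentiable_def by blast
  obtain d where d: "0 < d" "\<And>q. dist q p < d \<Longrightarrow> q \<in> W"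
    using W(1,2) by (auto simp: open_dist)
  have "G q = differential X tube q (V q)" if q: "q \<in> X" "dist q p < d" for q
  proof -
    have lin: "linear (frechet_derivative tube (at q))"
      using smooth_on_imp_has_derivative[OF smooth_tube UNIV_I] has_derivative_linear by blast
    have "V q \<in> tangent_space X q" using V q(1) by (auto simp: tangent_field_def)
    then have "differential X tube q (V q) = frechet_derivative tube (at q) (V q)"
      by (rule differential_tube_eq_frechet)
    also have "\<dots> = frechet_derivative tube (at q) (\<Sum>b\<in>Basis. (g q \<bullet> b) *\<^sub>R b)"
      using W(4) d(2)[OF q(2)] q(1) by (simp add: euclidean_representation)
    also have "\<dots> = G q"
      unfolding G_def by (simp only: linear_sum[OF lin] linear_cmul[OF lin])
    finally show ?thesis ..
  qed
  from has_derivative_transform_within[OF G' d(1) p this]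
  show ?thesis by (auto simp: differentiable_def)
qed

text \<open>
  Differentiating \<open>dF(V) \<bullet> N = 0\<close> along a curve with velocity \<open>\<tau>\<close> yields
  \<open>II(\<tau>, \<tau>) \<bullet> N = - dF(\<tau>) \<bullet> dN(\<tau>)\<close>, whichever field \<open>V\<close> was selected.
\<close>

lemma norm_second_fundamental_form_tube:
  assumes p: "x \<in> sphere 0 1" "z \<in> torus J"
    and \<tau>: "\<tau> \<in> tangent_space X (x, z)" "norm (differential X tube (x, z) \<tau>) = 1"
  shows "norm (second_fundamental_form X tube (x, z) \<tau> \<tau>) \<le> 1 + 2 * c"
proof -
  define V where "V = (SOME V. tangent_field X V \<and> V (x, z) = \<tau>)"
  have V: "tangent_field X V" "V (x, z) = \<tau>"
    using someI_ex[OF tangent_field_exists[OF p \<tau>(1)]] by (auto simp: V_def)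
  define h where "h = (\<lambda>q. differential X tube q (V q))"
  define y where "y = differential X h (x, z) \<tau>"
  define W where "W = differential X tube (x, z) ` tangent_space X (x, z)"
  define n where "n = normal_component W y"
  have II: "second_fundamental_form X tube (x, z) \<tau> \<tau> = n"
    by (simp add: second_fundamental_form_def n_def W_def y_def h_def V_def Let_def)
  obtain u \<xi> where t: "\<tau> = (u, torus_velocity \<xi> z)" "x \<bullet> u = 0"
    using \<tau>(1) by (rule tangent_spaceE)
  define \<gamma> where "\<gamma> = (\<lambda>t. (great_circle x u t, rotate_torus \<xi> t z))"
  have g: "range \<gamma> \<subseteq> X" "\<gamma> 0 = (x, z)" "(\<gamma> has_vector_derivative \<tau>) (at 0)"
    using tangent_spaceI(1-3)[OF p t(2), of \<xi>] unfolding \<gamma>_def t(1) by blast+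
  have "h differentiable (at (x, z) within X)"
    unfolding h_def by (rule field_derivative_differentiable[OF V(1)]) (use p in simp)
  then have dh: "((\<lambda>t. h (\<gamma> t)) has_vector_derivative y) (at 0)"
    unfolding y_def by (rule differential_along_curve[OF _ g])
  have dN: "((\<lambda>t. tube_normal (\<gamma> t)) has_vector_derivative U z (A \<xi> (L x) + L u)) (at 0)"
    unfolding \<gamma>_def by (rule tube_normal_along_curve[OF p(2)])
  have "h q \<bullet> tube_normal q = 0" if "q \<in> X" for q
    unfolding h_def using V(1) that
    by (intro differential_tube_inner_normal) (auto simp: tangent_field_def)
  then have "(\<lambda>t. h (\<gamma> t) \<bullet> tube_normal (\<gamma> t)) = (\<lambda>t. 0)"
    using g(1) by blast
  with bounded_bilinear.has_vector_derivative[OF bounded_bilinear_inner dh dN]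
  have "((\<lambda>t::real. 0::real) has_vector_derivative
      h (\<gamma> 0) \<bullet> U z (A \<xi> (L x) + L u) + y \<bullet> tube_normal (\<gamma> 0)) (at 0)"
    by simp
  then have "h (\<gamma> 0) \<bullet> U z (A \<xi> (L x) + L u) + y \<bullet> tube_normal (\<gamma> 0) = 0"
    using vector_derivative_unique_at[OF _ has_vector_derivative_const] by blast
  moreover have h0: "h (x, z) = U z (tube_velocity x u \<xi>)"
    unfolding h_def V(2) by (simp add: t(1) differential_tube[OF p t(2)])
  ultimately have yN: "y \<bullet> tube_normal (x, z) = - (tube_velocity x u \<xi> \<bullet> (A \<xi> (L x) + L u))"
    by (simp add: g(2) inner_U[OF p(2)])
  have "W = frechet_derivative tube (at (x, z)) ` tangent_space X (x, z)"
    unfolding W_def by (intro image_cong refl differential_tube_eq_frechet)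
  moreover have "linear (frechet_derivative tube (at (x, z)))"
    by (rule has_derivative_linear[OF smooth_on_imp_has_derivative[OF smooth_tube UNIV_I]])
  ultimately have "subspace W"
    by (simp only: linear_subspace_image subspace_tangent_space p)
  note nc = normal_component_props[OF this, of y, folded n_def]
  obtain \<beta> where b: "n = \<beta> *\<^sub>R tube_normal (x, z)"
    using orthogonal_to_tube[OF p, of n] nc(1) by (auto simp: W_def orthogonal_def)
  have N1: "norm (tube_normal (x, z)) = 1"
    using p by (simp add: tube_normal_def norm_U norm_L)
  have "(y - n) \<bullet> tube_normal (x, z) = 0"
    using nc(2) p differential_tube_inner_normal[of "(x, z)"] by (auto simp: W_def)
  then have "y \<bullet> tube_normal (x, z) = \<beta>"
    using N1 by (simp add: inner_diff_left b dot_square_norm)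
  then have "norm n = \<bar>tube_velocity x u \<xi> \<bullet> (A \<xi> (L x) + L u)\<bar>"
    using yN N1 by (simp add: b)
  also have "\<dots> \<le> (1 + 2 * c) * (norm (tube_velocity x u \<xi>))\<^sup>2"
    by (rule shape_operator_bound[OF p(1)])
  also have "norm (tube_velocity x u \<xi>) = 1"
    using \<tau>(2) by (simp add: t(1) differential_tube[OF p t(2)] norm_U[OF p(2)])
  finally show ?thesis by (simp add: II)
qed

theorem curv_perp_tube: "curv_perp X tube \<le> ereal (1 + 2 * c)"
  unfolding curv_perp_def
  by (rule SUP_least) (auto intro!: norm_second_fundamental_form_tube)

end

section \<open>Torus representations with prescribed characters\<close>

text \<open>
  On the unit circle this is the integral power; using the conjugate instead of the inverse makes it
  a polynomial in the real coordinates, hence smooth on the whole plane.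
\<close>

definition int_power :: "complex \<Rightarrow> int \<Rightarrow> complex" where
  "int_power w k = (if 0 \<le> k then w ^ nat k else cnj w ^ nat (- k))"

lemma norm_int_power: "norm w = 1 \<Longrightarrow> norm (int_power w k) = 1"
  by (simp add: int_power_def norm_power)

lemma int_power_cis_mult: "int_power (cis a * w) k = cis (of_int k * a) * int_power w k"
proof (cases "0 \<le> k")
  case True
  then obtain n where k: "k = int n" by (rule nonneg_int_cases)
  then show ?thesis
    by (simp add: int_power_def power_mult_distrib Complex.DeMoivre[of a n])
next
  case False
  then obtain n where k: "k = - int n" "0 < n" by (metis int_cases4 linorder_not_le of_nat_0_le_iff)
  then show ?thesis
    by (simp add: int_power_def power_mult_distrib cis_cnj Complex.DeMoivre[of "- a" n])
qed

lemma smooth_int_power: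
  assumes "smooth_on UNIV f"
  shows "smooth_on UNIV (\<lambda>x. int_power (f x) k)"
proof (cases "0 \<le> k")
  case True
  then show ?thesis unfolding int_power_def by (simp add: smooth_power assms)
next
  case False
  then show ?thesis
    unfolding int_power_def
    by (simp add: smooth_power smooth_bounded_linear[OF bounded_linear_cnj assms])
qed

definition pairing :: "'n set \<Rightarrow> ('n \<Rightarrow> int) \<Rightarrow> real ^ 'n::finite \<Rightarrow> real" where
  "pairing J m \<xi> = (\<Sum>j\<in>J. of_int (m j) * \<xi> $ j)"

definition character :: "'n set \<Rightarrow> ('n \<Rightarrow> int) \<Rightarrow> complex ^ 'n::finite \<Rightarrow> complex" where
  "character J m z = (\<Prod>j\<in>J. int_power (z $ j) (m j))"

lemma norm_character: "z \<in> torus J \<Longrightarrow> norm (character J m z) = 1"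
  by (simp add: character_def prod_norm[symmetric] norm_int_power torus_def)

lemma cis_sum: "cis (\<Sum>j\<in>J. f j) = (\<Prod>j\<in>J. cis (f j))"
  by (induction J rule: infinite_finite_induct) (auto simp flip: cis_mult)

lemma character_rotate_torus:
  "character J m (rotate_torus \<xi> t z) = cis (pairing J m \<xi> * t) * character J m z"
  by (simp add: character_def rotate_torus_def int_power_cis_mult prod.distrib pairing_def
      sum_distrib_right mult.assoc flip: cis_sum)

lemma smooth_character: "smooth_on UNIV (character J m)"
  unfolding character_def[abs_def]
  by (intro smooth_prod smooth_int_power smooth_linear bounded_linear_vec_nth)

lemma linear_pairing: "linear (pairing J m)"
  by (rule linearI) (simp_all add: pairing_def sum.distrib sum_distrib_left algebra_simps)

lemma inner_mult_unit:
  assumes "norm w = 1"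
  shows "(w * a) \<bullet> (w * b) = a \<bullet> (b::complex)"
proof -
  have "(w * a) \<bullet> (w * b) = (norm w)\<^sup>2 * (a \<bullet> b)"
    unfolding cmod_power2 by (simp add: inner_complex_def algebra_simps power2_eq_square)
  then show ?thesis using assms by simp
qed

text \<open>
  For each \<open>m \<in> M\<close> the torus acts by the character \<open>m\<close> on the plane spanned by \<open>e m\<close> and \<open>f m\<close>,
  identified with the complex numbers, and trivially on the orthogonal complement of these planes.
\<close>

locale torus_characters =
  fixes J :: "'n::finite set"
    and M :: "('n \<Rightarrow> int) set"
    and e f :: "('n \<Rightarrow> int) \<Rightarrow> 'b::euclidean_space"
  assumes finite_M: "finite M"
    and e_e: "m \<in> M \<Longrightarrow> m' \<in> M \<Longrightarrow> e m \<bullet> e m' = (if m = m' then 1 else 0)"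
    and f_f: "m \<in> M \<Longrightarrow> m' \<in> M \<Longrightarrow> f m \<bullet> f m' = (if m = m' then 1 else 0)"
    and e_f: "m \<in> M \<Longrightarrow> m' \<in> M \<Longrightarrow> e m \<bullet> f m' = 0"
begin

definition coord :: "('n \<Rightarrow> int) \<Rightarrow> 'b \<Rightarrow> complex" where
  "coord m y = Complex (y \<bullet> e m) (y \<bullet> f m)"

definition embed :: "(('n \<Rightarrow> int) \<Rightarrow> complex) \<Rightarrow> 'b" where
  "embed w = (\<Sum>m\<in>M. Re (w m) *\<^sub>R e m + Im (w m) *\<^sub>R f m)"

definition action :: "complex ^ 'n \<Rightarrow> 'b \<Rightarrow> 'b" where
  "action z y = y + embed (\<lambda>m. (character J m z - 1) * coord m y)"

definition generator :: "real ^ 'n \<Rightarrow> 'b \<Rightarrow> 'b" where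
  "generator \<xi> y = embed (\<lambda>m. \<i> * of_real (pairing J m \<xi>) * coord m y)"

lemma embed_cong: "(\<And>m. m \<in> M \<Longrightarrow> w m = w' m) \<Longrightarrow> embed w = embed w'"
  unfolding embed_def by (rule sum.cong) auto

lemma embed_add: "embed w + embed w' = embed (\<lambda>m. w m + w' m)"
  by (simp add: embed_def scaleR_add_left flip: sum.distrib) (simp add: algebra_simps)

lemma embed_scaleR: "r *\<^sub>R embed w = embed (\<lambda>m. r *\<^sub>R w m)"
  by (simp add: embed_def scaleR_sum_right scaleR_add_right)

lemma embed_inner: "embed w \<bullet> y = (\<Sum>m\<in>M. w m \<bullet> coord m y)"
  by (simp add: embed_def coord_def inner_sum_left inner_add_left inner_complex_def
      inner_commute[of y])

lemma coord_embed:
  assumes "m \<in> M"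
  shows "coord m (embed w) = w m"
proof -
  have "(\<Sum>k\<in>M. w k \<bullet> coord k (e m)) = (\<Sum>k\<in>M. if k = m then Re (w k) else 0)"
    using assms by (intro sum.cong) (auto simp: coord_def inner_complex_def e_e e_f)
  moreover have "(\<Sum>k\<in>M. w k \<bullet> coord k (f m)) = (\<Sum>k\<in>M. if k = m then Im (w k) else 0)"
    using assms
    by (intro sum.cong) (auto simp: coord_def inner_complex_def f_f e_f inner_commute[of "f _" "e _"])
  ultimately show ?thesis
    using assms finite_M by (simp add: coord_def embed_inner complex_eq_iff)
qed

lemma embed_inner_embed: "embed w \<bullet> embed w' = (\<Sum>m\<in>M. w m \<bullet> w' m)"
  by (simp add: embed_inner coord_embed cong: sum.cong)

lemma norm_embed: "(norm (embed w))\<^sup>2 = (\<Sum>m\<in>M. (norm (w m))\<^sup>2)"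
  by (simp add: power2_norm_eq_inner embed_inner_embed)

lemma coord_add: "coord m (y + y') = coord m y + coord m y'"
  by (simp add: coord_def inner_add_left complex_eq_iff)

lemma coord_scaleR: "coord m (r *\<^sub>R y) = r *\<^sub>R coord m y"
  by (simp add: coord_def complex_eq_iff)

lemma action_embed: "action z (embed w) = embed (\<lambda>m. character J m z * w m)"
  unfolding action_def embed_add
  by (rule embed_cong) (simp add: coord_embed algebra_simps)

lemma generator_embed: "generator \<xi> (embed w) = embed (\<lambda>m. \<i> * of_real (pairing J m \<xi>) * w m)"
  unfolding generator_def by (rule embed_cong) (simp add: coord_embed)

lemma linear_action: "linear (action z)"
proof (rule linearI)
  show "action z (y + y') = action z y + action z y'" for y y'
    by (simp add: action_def coord_add ring_distribs flip: embed_add)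
  show "action z (r *\<^sub>R y) = r *\<^sub>R action z y" for r y
    by (simp add: action_def coord_scaleR scaleR_add_right embed_scaleR)
qed

lemma linear_generator: "linear (generator \<xi>)"
proof (rule linearI)
  show "generator \<xi> (y + y') = generator \<xi> y + generator \<xi> y'" for y y'
    by (simp add: generator_def coord_add ring_distribs flip: embed_add)
  show "generator \<xi> (r *\<^sub>R y) = r *\<^sub>R generator \<xi> y" for r y
    by (simp add: generator_def coord_scaleR embed_scaleR)
qed

lemma linear_generator_left: "linear (\<lambda>\<xi>. generator \<xi> y)"
proof (rule linearI)
  show "generator (\<xi> + \<xi>') y = generator \<xi> y + generator \<xi>' y" for \<xi> \<xi>'
    by (simp add: generator_def linear_add[OF linear_pairing] ring_distribs flip: embed_add)
  show "generator (r *\<^sub>R \<xi>) y = r *\<^sub>R generator \<xi> y" for r \<xi>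
    by (simp add: generator_def linear_cmul[OF linear_pairing] embed_scaleR
        scaleR_conv_of_real[where 'a = complex] mult.assoc mult.left_commute)
qed

lemma generator_skew: "generator \<xi> y \<bullet> y' = - (y \<bullet> generator \<xi> y')"
  unfolding inner_commute[of y] generator_def embed_inner
  by (simp add: inner_complex_def algebra_simps flip: sum_negf)

lemma action_inner:
  assumes "z \<in> torus J"
  shows "action z y \<bullet> action z y' = y \<bullet> y'"
proof -
  let ?c = "\<lambda>m. (character J m z - 1) * coord m y"
  let ?c' = "\<lambda>m. (character J m z - 1) * coord m y'"
  have "action z y \<bullet> action z y' = y \<bullet> y' +
      ((\<Sum>m\<in>M. ?c m \<bullet> coord m y') + (\<Sum>m\<in>M. ?c' m \<bullet> coord m y) + (\<Sum>m\<in>M. ?c m \<bullet> ?c' m))"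
    unfolding action_def inner_add_left inner_add_right embed_inner_embed
      inner_commute[of y "embed _"]
    by (simp only: embed_inner add_ac)
  also have "(\<Sum>m\<in>M. ?c m \<bullet> coord m y') + (\<Sum>m\<in>M. ?c' m \<bullet> coord m y) + (\<Sum>m\<in>M. ?c m \<bullet> ?c' m) = 0"
    unfolding sum.distrib[symmetric]
  proof (rule sum.neutral, rule ballI)
    fix m
    have "(character J m z * coord m y) \<bullet> (character J m z * coord m y') = coord m y \<bullet> coord m y'"
      by (rule inner_mult_unit[OF norm_character[OF assms]])
    then show "?c m \<bullet> coord m y' + ?c' m \<bullet> coord m y + ?c m \<bullet> ?c' m = 0"
      by (simp add: left_diff_distrib inner_diff_left inner_diff_right inner_commute)
  qed
  finally show ?thesis by simp
qed

lemma action_derivative: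
  "((\<lambda>t. action (rotate_torus \<xi> t z) y) has_vector_derivative action z (generator \<xi> y)) (at 0)"
proof -
  let ?w = "\<lambda>t m. (cis (pairing J m \<xi> * t) * character J m z - 1) * coord m y"
  let ?w' = "\<lambda>m. (\<i> * of_real (pairing J m \<xi>) * character J m z) * coord m y"
  have w: "((\<lambda>t. ?w t m) has_vector_derivative (\<i> * of_real (pairing J m \<xi>) * character J m z - 0)
      * coord m y) (at 0)" for m
    by (intro has_vector_derivative_mult_left has_vector_derivative_diff has_vector_derivative_cis
        has_vector_derivative_const)
  have "((\<lambda>t. y + (\<Sum>m\<in>M. Re (?w t m) *\<^sub>R e m + Im (?w t m) *\<^sub>R f m)) has_vector_derivative
      0 + (\<Sum>m\<in>M. Re ((\<i> * of_real (pairing J m \<xi>) * character J m z - 0) * coord m y) *\<^sub>R e m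
        + Im ((\<i> * of_real (pairing J m \<xi>) * character J m z - 0) * coord m y) *\<^sub>R f m)) (at 0)"
    by (intro has_vector_derivative_add has_vector_derivative_const has_vector_derivative_sum
        bounded_linear.has_vector_derivative[OF bounded_linear_scaleR_left]
        bounded_linear.has_vector_derivative[OF bounded_linear_Re w]
        bounded_linear.has_vector_derivative[OF bounded_linear_Im w])
  then have "((\<lambda>t. y + embed (?w t)) has_vector_derivative embed ?w') (at 0)"
    by (simp only: embed_def diff_zero add_0_left)
  moreover have "action z (generator \<xi> y) = embed ?w'"
    unfolding generator_def action_embed by (rule embed_cong) (simp add: mult_ac)
  ultimately show ?thesis
    by (simp only: action_def character_rotate_torus)
qed

lemma smooth_action: "smooth_on UNIV (\<lambda>z. action z y)"
proof -
  have w: "smooth_on UNIV (\<lambda>z. (character J m z + (-1)) * coord m y)" for m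
    by (intro smooth_mult smooth_add smooth_character smooth_const)
  have "smooth_on UNIV (\<lambda>z. y + (\<Sum>m\<in>M. Re ((character J m z + (-1)) * coord m y) *\<^sub>R e m
      + Im ((character J m z + (-1)) * coord m y) *\<^sub>R f m))"
    by (intro smooth_add smooth_const smooth_sum
        smooth_bounded_linear[OF bounded_linear_scaleR_left]
        smooth_bounded_linear[OF bounded_linear_Re w] smooth_bounded_linear[OF bounded_linear_Im w])
  then show ?thesis
    by (simp only: action_def embed_def diff_conv_add_uminus)
qed

end

text \<open>
Two Euclidean spaces of the same dimension are isometric; orthogonal complements have complementary dimension.
\<close>

lemma isometry_onto_orthogonal_complement:
  fixes W :: "'b::euclidean_space set"
  assumes "subspace W" "DIM('a::euclidean_space) + dim W = DIM('b)"
  obtains L :: "'a::euclidean_space \<Rightarrow> 'b"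
  where "linear L" "\<And>x. norm (L x) = norm x" "range L = {y. \<forall>w\<in>W. y \<bullet> w = 0}"
proof -
  let ?C = "{y. \<forall>w\<in>W. y \<bullet> w = 0}"
  have eq: "?C = {y \<in> UNIV. \<forall>x\<in>W. orthogonal x y}"
    by (auto simp: orthogonal_def inner_commute)
  have "dim ?C + dim W = DIM('b)"
    unfolding eq using dim_subspace_orthogonal_to_vectors[OF assms(1) subspace_UNIV subset_UNIV]
    by (simp only: dim_UNIV)
  then have d: "dim (UNIV :: 'a set) = dim ?C" using assms(2) by simp
  have s: "subspace ?C"
    by (auto simp: subspace_def inner_add_left)
  obtain L :: "'a \<Rightarrow> 'b" where L: "linear L" "L ` UNIV = ?C" "\<And>x. x \<in> UNIV \<Longrightarrow> norm (L x) = norm x"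
    by (rule isometries_subspaces[OF subspace_UNIV s d]) blast
  show thesis by (rule that[OF L(1) L(3)[OF UNIV_I] L(2)])
qed

context torus_characters
begin

text \<open>
  For the orbit of the vector with coordinate \<open>a m\<close> in the \<open>m\<close>-th plane, the squared speed and the squared
  acceleration in direction \<open>\<xi>\<close> are the second and fourth moments of the linear form \<open>\<xi>\<close> over the
  vectors \<open>m\<close> with weights \<open>(a m)\<^sup>2\<close>. A curvature bound is therefore an inequality between moments.
\<close>

theorem tube_immersion_exists:
  fixes a :: "('n \<Rightarrow> int) \<Rightarrow> real" and c :: real
  assumes dim: "DIM('a::euclidean_space) + card J = DIM('b)"
    and mass: "(\<Sum>m\<in>M. (a m)\<^sup>2) \<le> 1"
    and c: "0 \<le> c"
    and quartic: "\<And>\<xi>. (\<Sum>m\<in>M. (a m)\<^sup>2 * pairing J m \<xi> ^ 4)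
      \<le> c\<^sup>2 * (\<Sum>m\<in>M. (a m)\<^sup>2 * (pairing J m \<xi>)\<^sup>2)\<^sup>2"
    and definite: "\<And>\<xi> j. (\<Sum>m\<in>M. (a m)\<^sup>2 * (pairing J m \<xi>)\<^sup>2) = 0 \<Longrightarrow> j \<in> J \<Longrightarrow> \<xi> $ j = 0"
  shows "\<exists>F :: 'a \<times> (complex ^ 'n) \<Rightarrow> 'b.
    immersion_on (sphere 0 1 \<times> torus J) F \<and> F ` (sphere 0 1 \<times> torus J) \<subseteq> cball 0 1
    \<and> curv_perp (sphere 0 1 \<times> torus J) F \<le> ereal (1 + 2 * c)"
proof -
  define v0 where "v0 = embed (\<lambda>m. of_real (a m))"
  have v0: "(norm v0)\<^sup>2 = (\<Sum>m\<in>M. (a m)\<^sup>2)"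
    by (simp add: v0_def norm_embed)
  have Av0: "(norm (generator \<xi> v0))\<^sup>2 = (\<Sum>m\<in>M. (a m)\<^sup>2 * (pairing J m \<xi>)\<^sup>2)" for \<xi>
    by (simp add: v0_def generator_embed norm_embed norm_mult power_mult_distrib mult.commute)
  have AAv0: "(norm (generator \<xi> (generator \<xi> v0)))\<^sup>2 = (\<Sum>m\<in>M. (a m)\<^sup>2 * pairing J m \<xi> ^ 4)" for \<xi>
  proof -
    have "p ^ 4 = p\<^sup>2 * p\<^sup>2" for p :: real by (simp flip: power_add)
    then show ?thesis
      unfolding v0_def generator_embed norm_embed
      by (intro sum.cong) (simp_all add: norm_mult power_mult_distrib)
  qed
  have zero: "\<xi> $ j = 0" if "generator \<xi> v0 = 0" "j \<in> J" for \<xi> j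
    using definite[of \<xi> j] that Av0[of \<xi>] by simp
  let ?S = "{\<xi> :: real ^ 'n. \<forall>j. j \<notin> J \<longrightarrow> \<xi> $ j = 0}"
  have depends: "generator \<xi> y = 0" if "\<And>j. j \<in> J \<Longrightarrow> \<xi> $ j = 0" for \<xi> y
  proof -
    have "pairing J m \<xi> = 0" for m using that by (simp add: pairing_def)
    then show ?thesis by (simp add: generator_def embed_def)
  qed
  have lin: "linear (\<lambda>\<xi>. generator \<xi> v0)" by (rule linear_generator_left)
  have sS: "subspace ?S" by (auto simp: subspace_def)
  have "inj_on (\<lambda>\<xi>. generator \<xi> v0) ?S"
  proof (rule inj_onI)
    fix \<xi> \<xi>' assume s: "\<xi> \<in> ?S" "\<xi>' \<in> ?S" and "generator \<xi> v0 = generator \<xi>' v0"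
    then have "generator (\<xi> - \<xi>') v0 = 0" by (simp add: linear_diff[OF lin])
    from zero[OF this] have "\<xi> $ j = \<xi>' $ j" for j using s by (cases "j \<in> J") auto
    then show "\<xi> = \<xi>'" by (simp add: vec_eq_iff)
  qed
  then have "dim ((\<lambda>\<xi>. generator \<xi> v0) ` ?S) = dim ?S"
    using sS by (intro dim_image_eq[OF lin]) (simp add: span_eq_iff[THEN iffD2])
  also have "dim ?S = card J"
    using dim_substandard_cart[where d = J and 'a = real] by (simp add: dim_vec_eq)
  also have "(\<lambda>\<xi>. generator \<xi> v0) ` ?S = range (\<lambda>\<xi>. generator \<xi> v0)"
  proof (rule equalityI[OF image_mono[OF subset_UNIV]], rule subsetI)
    fix y assume "y \<in> range (\<lambda>\<xi>. generator \<xi> v0)"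
    then obtain \<xi> where y: "y = generator \<xi> v0" by blast
    define \<xi>' where "\<xi>' = (\<chi> j. if j \<in> J then \<xi> $ j else 0)"
    have "generator (\<xi> - \<xi>') v0 = 0" by (rule depends) (simp add: \<xi>'_def)
    then have "y = generator \<xi>' v0" using y by (simp add: linear_diff[OF lin])
    then show "y \<in> (\<lambda>\<xi>. generator \<xi> v0) ` ?S" by (auto simp: \<xi>'_def)
  qed
  finally have dW: "DIM('a) + dim (range (\<lambda>\<xi>. generator \<xi> v0)) = DIM('b)"
    using dim by simp
  obtain L :: "'a \<Rightarrow> 'b" where L: "linear L" "\<And>x. norm (L x) = norm x"
    "range L = {y. \<forall>w\<in>range (\<lambda>\<xi>. generator \<xi> v0). y \<bullet> w = 0}"
    by (rule isometry_onto_orthogonal_complement[OF linear_subspace_image[OF lin subspace_UNIV] dW])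
      blast
  have "torus_orbit J action generator v0 L c"
  proof (rule torus_orbit.intro)
    show "norm v0 \<le> 1"
      using mass unfolding v0[symmetric] by (simp add: power_le_one_iff)
    show "norm (generator \<xi> (generator \<xi> v0)) \<le> c * (norm (generator \<xi> v0))\<^sup>2" for \<xi>
    proof (rule power2_le_imp_le)
      show "(norm (generator \<xi> (generator \<xi> v0)))\<^sup>2 \<le> (c * (norm (generator \<xi> v0))\<^sup>2)\<^sup>2"
        using quartic[of \<xi>] unfolding Av0[symmetric] AAv0[symmetric] power_mult_distrib .
    qed (use c in simp)
    show "range L = {y. \<forall>\<xi>. y \<bullet> generator \<xi> v0 = 0}" using L(3) by auto
  qed (rule linear_action smooth_action action_inner action_derivative linear_generator
      linear_generator_left generator_skew c zero depends L(1) L(2); assumption)+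
  then interpret torus_orbit J action generator v0 L c .
  show ?thesis
    using immersion_tube tube_in_ball curv_perp_tube by blast
qed

end

section \<open>Integral vectors forming a weighted design of degree four\<close>

definition shell :: "'n::finite set \<Rightarrow> int \<Rightarrow> ('n \<Rightarrow> int) set" where
  "shell J \<rho> = {m. (\<forall>j. j \<notin> J \<longrightarrow> m j = 0) \<and> (\<Sum>j\<in>J. (m j)\<^sup>2) = \<rho>}"

definition quartic_sum :: "'n::finite set \<Rightarrow> ('n \<Rightarrow> int) \<Rightarrow> int" where
  "quartic_sum J m = (\<Sum>j\<in>J. m j ^ 4)"

lemma
  fixes J :: "'n::finite set"
  shows finite_shell: "finite (shell J \<rho>)"
  and card_shell_le: "0 \<le> \<rho> \<Longrightarrow> card (shell J \<rho>) \<le> nat (2 * \<rho> + 1) ^ card J"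
proof -
  let ?P = "J \<rightarrow>\<^sub>E {-\<rho>..\<rho>}"
  have sub: "(\<lambda>m. restrict m J) ` shell J \<rho> \<subseteq> ?P"
  proof (clarsimp simp: shell_def)
    fix m :: "'n \<Rightarrow> int" and j assume j: "j \<in> J"
    have "(m j)\<^sup>2 \<le> (\<Sum>j\<in>J. (m j)\<^sup>2)"
      by (rule member_le_sum[OF j]) auto
    moreover have "\<bar>m j\<bar> \<le> (m j)\<^sup>2"
    proof (cases "m j = 0")
      case False
      then have "\<bar>m j\<bar> * 1 \<le> \<bar>m j\<bar> * \<bar>m j\<bar>" by (intro mult_left_mono) auto
      then show ?thesis by (simp add: power2_eq_square flip: abs_mult)
    qed simp
    ultimately show "- (\<Sum>j\<in>J. (m j)\<^sup>2) \<le> m j \<and> m j \<le> (\<Sum>j\<in>J. (m j)\<^sup>2)"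
      by linarith
  qed
  have inj: "inj_on (\<lambda>m. restrict m J) (shell J \<rho>)"
  proof (rule inj_onI, rule ext)
    fix m m' j assume m: "m \<in> shell J \<rho>" "m' \<in> shell J \<rho>" "restrict m J = restrict m' J"
    show "m j = m' j"
      using m(1,2) fun_cong[OF m(3), of j] by (cases "j \<in> J") (auto simp: shell_def)
  qed
  have fin: "finite ?P" by (intro finite_PiE) auto
  show "finite (shell J \<rho>)"
    using finite_subset[OF sub fin] inj by (rule finite_imageD)
  show "card (shell J \<rho>) \<le> nat (2 * \<rho> + 1) ^ card J" if "0 \<le> \<rho>"
  proof -
    have "card (shell J \<rho>) \<le> card ?P"
      by (rule card_inj_on_le[OF inj sub fin])
    also have "card ?P = nat (2 * \<rho> + 1) ^ card J"
      by (simp add: card_PiE algebra_simps)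
    finally show ?thesis .
  qed
qed

definition flip :: "'n \<Rightarrow> ('n \<Rightarrow> int) \<Rightarrow> 'n \<Rightarrow> int" where
  "flip a m = m(a := - m a)"

text \<open>
  Weights that depend on \<open>m\<close> only through \<open>quartic_sum J m\<close> are invariant under all signed permutations
  of the coordinates. Sign changes and transpositions suffice to determine the moments.
\<close>

lemma sum_shell_flip:
  fixes h :: "int \<Rightarrow> real"
  shows "(\<Sum>m\<in>shell J \<rho>. h (quartic_sum J m) * g (flip a m))
    = (\<Sum>m\<in>shell J \<rho>. h (quartic_sum J m) * g m)"
proof -
  have sq: "(flip a m j)\<^sup>2 = (m j)\<^sup>2" and qu: "flip a m j ^ 4 = m j ^ 4" for m j
    by (auto simp: flip_def)
  have "flip a m \<in> shell J \<rho>" if "m \<in> shell J \<rho>" for m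
    using that by (simp add: shell_def sq) (simp add: flip_def)
  moreover have "quartic_sum J (flip a m) = quartic_sum J m" for m
    by (simp add: quartic_sum_def qu)
  moreover have "flip a (flip a m) = m" for m
    by (simp add: flip_def)
  ultimately show ?thesis
    by (intro sum.reindex_bij_witness[where i = "flip a" and j = "flip a"]) auto
qed

lemma sum_shell_swap:
  fixes h :: "int \<Rightarrow> real"
  assumes "a \<in> J" "b \<in> J"
  shows "(\<Sum>m\<in>shell J \<rho>. h (quartic_sum J m) * g (m \<circ> Transposition.transpose a b))
    = (\<Sum>m\<in>shell J \<rho>. h (quartic_sum J m) * g m)"
proof -
  have p: "Transposition.transpose a b permutes J" using assms by (rule permutes_swap_id)
  have inv: "(\<Sum>j\<in>J. f ((m \<circ> Transposition.transpose a b) j)) = (\<Sum>j\<in>J. f (m j))" for f :: "int \<Rightarrow> int" and m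
    using sum.permute[OF p, of "\<lambda>j. f (m j)"] by (simp add: o_def)
  have "Transposition.transpose a b j \<notin> J" if "j \<notin> J" for j
    using that assms by (metis transpose_apply_other)
  then have "m \<circ> Transposition.transpose a b \<in> shell J \<rho>" if "m \<in> shell J \<rho>" for m
    using that inv[of "\<lambda>x. x\<^sup>2" m] by (simp add: shell_def)
  moreover have "quartic_sum J (m \<circ> Transposition.transpose a b) = quartic_sum J m" for m
    using inv[of "\<lambda>x. x ^ 4" m] by (simp add: quartic_sum_def)
  moreover have "m \<circ> Transposition.transpose a b \<circ> Transposition.transpose a b = m" for m
    by (simp add: fun_eq_iff)
  ultimately show ?thesis
    by (intro sum.reindex_bij_witness[where i = "\<lambda>m. m \<circ> Transposition.transpose a b"
          and j = "\<lambda>m. m \<circ> Transposition.transpose a b"]) auto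
qed

text \<open>
  For points on a sphere with weights invariant under signed permutations, being a design of degree
  four is the single condition that the mean of the sum of fourth powers of the coordinates is the
  one of the uniform measure, \<open>3 * \<rho>\<^sup>2 / (n + 2)\<close>.
\<close>

locale quartic_design =
  fixes J :: "'n::finite set" and \<rho> :: int and h :: "int \<Rightarrow> real"
  assumes J_nonempty: "J \<noteq> {}"
    and total_weight: "(\<Sum>m\<in>shell J \<rho>. h (quartic_sum J m)) = 1"
    and mean_quartic_sum: "(\<Sum>m\<in>shell J \<rho>. h (quartic_sum J m) * real_of_int (quartic_sum J m))
      = 3 * (real_of_int \<rho>)\<^sup>2 / (real (card J) + 2)"
begin

definition mean :: "(('n \<Rightarrow> int) \<Rightarrow> real) \<Rightarrow> real" where
  "mean g = (\<Sum>m\<in>shell J \<rho>. h (quartic_sum J m) * g m)"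

abbreviation "n_dim \<equiv> real (card J)"

lemma n_dim_pos: "0 < n_dim"
  using J_nonempty by (simp add: card_gt_0_iff)

lemma mean_flip: "mean (\<lambda>m. g (flip a m)) = mean g"
  unfolding mean_def by (rule sum_shell_flip)

lemma mean_swap: "a \<in> J \<Longrightarrow> b \<in> J \<Longrightarrow> mean (\<lambda>m. g (m \<circ> Transposition.transpose a b)) = mean g"
  unfolding mean_def by (rule sum_shell_swap)

lemma mean_cmult: "mean (\<lambda>m. r * g m) = r * mean g"
  by (simp add: mean_def sum_distrib_left mult.left_commute)

lemma mean_sum: "mean (\<lambda>m. \<Sum>i\<in>I. g i m) = (\<Sum>i\<in>I. mean (g i))"
  unfolding mean_def by (simp add: sum_distrib_left) (rule sum.swap)

lemma mean_cong: "(\<And>m. m \<in> shell J \<rho> \<Longrightarrow> g m = g' m) \<Longrightarrow> mean g = mean g'"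
  by (simp add: mean_def)

lemma second_moment:
  assumes "i \<in> J" "j \<in> J"
  shows "mean (\<lambda>m. real_of_int (m i * m j)) = (if i = j then real_of_int \<rho> / n_dim else 0)"
proof (cases "i = j")
  case True
  have eq: "mean (\<lambda>m. real_of_int (m k * m k)) = mean (\<lambda>m. real_of_int (m i * m i))" if "k \<in> J" for k
    using mean_swap[OF assms(1) that, of "\<lambda>m. real_of_int (m i) * real_of_int (m i)"] by simp
  have "(\<Sum>k\<in>J. mean (\<lambda>m. real_of_int (m k * m k))) = mean (\<lambda>m. \<Sum>k\<in>J. real_of_int (m k * m k))"
    by (simp add: mean_sum)
  also have "\<dots> = mean (\<lambda>m. real_of_int \<rho>)"
    by (rule mean_cong) (simp add: shell_def power2_eq_square flip: of_int_sum of_int_mult)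
  also have "\<dots> = \<rho>"
    using mean_cmult[of "real_of_int \<rho>" "\<lambda>m. 1"] total_weight by (simp add: mean_def)
  finally have "n_dim * mean (\<lambda>m. real_of_int (m i * m i)) = \<rho>"
    using eq by (simp del: of_int_mult)
  then show ?thesis
    using True J_nonempty nonzero_mult_div_cancel_left[of n_dim "mean (\<lambda>m. real_of_int (m i * m i))"]
    by (simp del: of_int_mult)
next
  case False
  have "mean (\<lambda>m. real_of_int (m i * m j)) = mean (\<lambda>m. - 1 * real_of_int (m i * m j))"
    using mean_flip[of "\<lambda>m. real_of_int (m i * m j)" i] False by (simp add: flip_def)
  then show ?thesis
    using False unfolding mean_cmult by simp
qed

definition fourth_moment :: "'n \<Rightarrow> 'n \<Rightarrow> 'n \<Rightarrow> 'n \<Rightarrow> real" where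
  "fourth_moment i j k l = mean (\<lambda>m. real_of_int (m i * m j * m k * m l))"

text \<open>
The mean of \<open>x\<^sub>1\<^sup>2 * x\<^sub>2\<^sup>2\<close> over the sphere of squared radius \<open>\<rho>\<close>.
\<close>

definition "quartic_constant = (real_of_int \<rho>)\<^sup>2 / (n_dim * (n_dim + 2))"

lemma fourth_moment_flip:
  "fourth_moment i j k l = (if a = i then -1 else 1) * (if a = j then -1 else 1)
    * (if a = k then -1 else 1) * (if a = l then -1 else 1) * fourth_moment i j k l"
proof -
  have "fourth_moment i j k l = mean (\<lambda>m. real_of_int (flip a m i * flip a m j * flip a m k * flip a m l))"
    unfolding fourth_moment_def by (rule mean_flip[symmetric])
  also have "\<dots> = mean (\<lambda>m. ((if a = i then -1 else 1) * (if a = j then -1 else 1)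
    * (if a = k then -1 else 1) * (if a = l then -1 else 1)) * real_of_int (m i * m j * m k * m l))"
    by (rule mean_cong) (simp add: flip_def)
  finally show ?thesis unfolding mean_cmult fourth_moment_def .
qed

lemma fourth_moment_diagonal:
  assumes "i \<in> J"
  shows "fourth_moment i i i i = 3 * quartic_constant"
proof -
  have eq: "fourth_moment k k k k = fourth_moment i i i i" if "k \<in> J" for k
    using mean_swap[OF assms that, of "\<lambda>m. real_of_int (m i * m i * m i * m i)"]
    by (simp add: fourth_moment_def)
  have "(\<Sum>k\<in>J. fourth_moment k k k k) = mean (\<lambda>m. quartic_sum J m)"
    unfolding fourth_moment_def mean_sum[symmetric]
    by (rule mean_cong) (simp add: quartic_sum_def power4_eq_xxxx)
  also have "\<dots> = 3 * (real_of_int \<rho>)\<^sup>2 / (n_dim + 2)"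
    using mean_quartic_sum by (simp add: mean_def)
  finally have "n_dim * fourth_moment i i i i = 3 * (real_of_int \<rho>)\<^sup>2 / (n_dim + 2)"
    using eq by simp
  moreover have "F = 3 * (r / (n * (n + 2)))" if "n * F = 3 * r / (n + 2)" "0 < n" for n F r :: real
  proof -
    have "F = (n * F) / n" using that(2) by simp
    also have "\<dots> = 3 * (r / (n * (n + 2)))" unfolding that(1) by simp
    finally show ?thesis .
  qed
  ultimately show ?thesis
    unfolding quartic_constant_def using n_dim_pos by blast
qed

text \<open>
  Summing over the second index gives \<open>\<rho>\<close> times a second moment, because all vectors have the same
  length; the diagonal term is known and the remaining ones are equal by symmetry.
\<close>

lemma fourth_moment_pairs:
  assumes ij: "i \<in> J" "j \<in> J" "i \<noteq> j"
  shows "fourth_moment i i j j = quartic_constant"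
proof -
  have eq: "fourth_moment i i k k = fourth_moment i i j j" if "k \<in> J - {i}" for k
  proof -
    have "Transposition.transpose j k i = i"
      using that ij by (auto simp: Transposition.transpose_def)
    then show ?thesis
      using mean_swap[of j k "\<lambda>m. real_of_int (m i * m i * m j * m j)"] that ij
      by (simp add: fourth_moment_def)
  qed
  have "(\<Sum>k\<in>J. fourth_moment i i k k) = mean (\<lambda>m. real_of_int \<rho> * (real_of_int (m i) * real_of_int (m i)))"
    unfolding fourth_moment_def mean_sum[symmetric]
  proof (rule mean_cong)
    fix m assume "m \<in> shell J \<rho>"
    then have "\<rho> = (\<Sum>k\<in>J. m k * m k)" by (simp add: shell_def power2_eq_square)
    then show "(\<Sum>k\<in>J. real_of_int (m i * m i * m k * m k))
        = real_of_int \<rho> * (real_of_int (m i) * real_of_int (m i))"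
      by (simp add: sum_distrib_left sum_distrib_right mult_ac)
  qed
  also have "\<dots> = (real_of_int \<rho>)\<^sup>2 / n_dim"
    using second_moment[OF ij(1) ij(1)] unfolding mean_cmult by (simp add: power2_eq_square)
  finally have "fourth_moment i i i i + (\<Sum>k\<in>J - {i}. fourth_moment i i k k) = (real_of_int \<rho>)\<^sup>2 / n_dim"
    using ij(1) by (simp add: sum.remove)
  moreover have "(\<Sum>k\<in>J - {i}. fourth_moment i i k k) = (n_dim - 1) * fourth_moment i i j j"
  proof -
    have "Suc (card (J - {i})) = card J" using ij(1) by (intro card_Suc_Diff1) auto
    then have "real (card (J - {i})) = n_dim - 1" by linarith
    then show ?thesis using eq by (simp only: sum.cong[OF refl eq] sum_constant)
  qed
  moreover have "(n - 1) * F = (n - 1) * (r / (n * (n + 2)))"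
    if "3 * (r / (n * (n + 2))) + (n - 1) * F = r / n" "0 < n" for n F r :: real
  proof -
    have "(n - 1) * F = r / n - 3 * (r / (n * (n + 2)))" using that(1) by simp
    also have "r / n = (r * (n + 2)) / (n * (n + 2))" using that(2) by simp
    also have "\<dots> - 3 * (r / (n * (n + 2))) = (n - 1) * (r / (n * (n + 2)))"
      unfolding times_divide_eq_right diff_divide_distrib[symmetric] by (simp add: algebra_simps)
    finally show ?thesis .
  qed
  ultimately have "(n_dim - 1) * fourth_moment i i j j = (n_dim - 1) * quartic_constant"
    using fourth_moment_diagonal[OF ij(1)] n_dim_pos unfolding quartic_constant_def by simp
  moreover have "card {i, j} \<le> card J"
    using ij by (intro card_mono) auto
  then have "n_dim \<noteq> 1" using ij(3) by simp
  ultimately show ?thesis by simp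
qed

text \<open>
Unless the four indices pair up, one of them occurs an odd number of times, and a sign change there forces the moment to vanish.
\<close>

lemma fourth_moment_isotropic:
  assumes "i \<in> J" "j \<in> J" "k \<in> J" "l \<in> J"
  shows "fourth_moment i j k l = quartic_constant *
    (of_bool (i = j) * of_bool (k = l) + of_bool (i = k) * of_bool (j = l)
      + of_bool (i = l) * of_bool (j = k))"
proof -
  have perm: "fourth_moment i j i j = fourth_moment i i j j" "fourth_moment i j j i = fourth_moment i i j j"
    for i j
    unfolding fourth_moment_def by (simp_all add: mult_ac)
  consider "i = j" "k = l" "i = k" | "i = j" "k = l" "i \<noteq> k" | "i = k" "j = l" "i \<noteq> j"
    | "i = l" "j = k" "i \<noteq> j"
    | a where "(if a = i then -1 else 1) * (if a = j then -1 else 1)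
        * (if a = k then -1 else 1) * (if a = l then -1 else 1) = (-1 :: real)"
      "\<not> (i = j \<and> k = l)" "\<not> (i = k \<and> j = l)" "\<not> (i = l \<and> j = k)"
  proof -
    have "\<exists>a. (if a = i then -1 else 1) * (if a = j then -1 else 1)
        * (if a = k then -1 else 1) * (if a = l then -1 else 1) = (-1 :: real)"
      if "\<not> (i = j \<and> k = l)" "\<not> (i = k \<and> j = l)" "\<not> (i = l \<and> j = k)"
    proof (cases "i = j")
      case True
      \<comment> \<open>k occurs once unless it equals i = j, in which case l occurs once.\<close>
      then show ?thesis
        using that by (intro exI[of _ "if k = i then l else k"]) auto
    next
      case False
      show ?thesis
      proof (cases "i = k \<or> i = l")
        case True
        then show ?thesis using that False by (intro exI[of _ j]) auto
      next
        case F: False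
        then show ?thesis using that False by (intro exI[of _ i]) auto
      qed
    qed
    then show thesis using that by blast
  qed
  then show ?thesis
  proof cases
    case 1
    then show ?thesis using fourth_moment_diagonal[OF assms(1)] by simp
  next
    case 2
    then show ?thesis using fourth_moment_pairs[OF assms(1,3)] by simp
  next
    case 3
    then show ?thesis using fourth_moment_pairs[OF assms(1,2)] perm(1)[of i j] by simp
  next
    case 4
    then show ?thesis using fourth_moment_pairs[OF assms(1,2)] perm(2)[of i j] by simp
  next
    case (5 a)
    have "fourth_moment i j k l = 0"
      using fourth_moment_flip[of i j k l a] unfolding 5(1) by simp
    then show ?thesis using 5(2-4) by auto
  qed
qed

lemma mean_pairing_square:
  "mean (\<lambda>m. (pairing J m \<xi>)\<^sup>2) = real_of_int \<rho> / n_dim * (\<Sum>j\<in>J. (\<xi> $ j)\<^sup>2)"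
proof -
  have "mean (\<lambda>m. (pairing J m \<xi>)\<^sup>2)
      = mean (\<lambda>m. \<Sum>i\<in>J. \<Sum>j\<in>J. (\<xi> $ i * \<xi> $ j) * real_of_int (m i * m j))"
    by (rule mean_cong) (simp add: pairing_def power2_eq_square sum_product mult_ac)
  also have "\<dots> = (\<Sum>i\<in>J. \<Sum>j\<in>J. (\<xi> $ i * \<xi> $ j) * (if i = j then real_of_int \<rho> / n_dim else 0))"
    unfolding mean_sum mean_cmult using second_moment by (intro sum.cong refl) simp
  also have "\<dots> = (\<Sum>i\<in>J. (\<xi> $ i * \<xi> $ i) * (real_of_int \<rho> / n_dim))"
    by (intro sum.cong refl) (simp add: if_distrib[of "(*) _"] cong: if_cong)
  finally show ?thesis
    by (simp add: sum_distrib_right sum_divide_distrib sum_distrib_left power2_eq_square mult_ac)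
qed

lemma mean_pairing_quartic:
  "mean (\<lambda>m. pairing J m \<xi> ^ 4) = 3 * quartic_constant * (\<Sum>j\<in>J. (\<xi> $ j)\<^sup>2)\<^sup>2"
proof -
  let ?x = "\<lambda>i. \<xi> $ i"
  define Q where "Q = (\<Sum>j\<in>J. (\<xi> $ j)\<^sup>2)"
  have "mean (\<lambda>m. pairing J m \<xi> ^ 4) = mean (\<lambda>m. \<Sum>i\<in>J. \<Sum>j\<in>J. \<Sum>k\<in>J. \<Sum>l\<in>J.
      (?x i * ?x j * ?x k * ?x l) * real_of_int (m i * m j * m k * m l))"
  proof (rule mean_cong)
    fix m :: "'n \<Rightarrow> int"
    have "pairing J m \<xi> ^ 4 = (pairing J m \<xi> * pairing J m \<xi>) * (pairing J m \<xi> * pairing J m \<xi>)"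
      by (simp add: power4_eq_xxxx)
    then show "pairing J m \<xi> ^ 4 = (\<Sum>i\<in>J. \<Sum>j\<in>J. \<Sum>k\<in>J. \<Sum>l\<in>J.
      (?x i * ?x j * ?x k * ?x l) * real_of_int (m i * m j * m k * m l))"
      by (simp add: pairing_def sum_distrib_left sum_distrib_right mult_ac)
  qed
  also have "\<dots> = (\<Sum>i\<in>J. \<Sum>j\<in>J. \<Sum>k\<in>J. \<Sum>l\<in>J. (?x i * ?x j * ?x k * ?x l) *
      (quartic_constant * (of_bool (i = j) * of_bool (k = l) + of_bool (i = k) * of_bool (j = l)
      + of_bool (i = l) * of_bool (j = k))))"
    unfolding mean_sum mean_cmult fourth_moment_def[symmetric]
    using fourth_moment_isotropic by (intro sum.cong refl) simp
  also have "\<dots> = (\<Sum>i\<in>J. \<Sum>j\<in>J. quartic_constant *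
      ((?x i * ?x j) * of_bool (i = j) * Q + 2 * ((?x i)\<^sup>2 * (?x j)\<^sup>2)))"
  proof (intro sum.cong refl)
    fix i j assume ij: "i \<in> J" "j \<in> J"
    have d: "(\<Sum>k\<in>J. ?x k * of_bool (a = k)) = ?x a" if "a \<in> J" for a
      using that by (simp add: of_bool_def if_distrib[of "(*) _"] cong: if_cong)
    have Q: "(\<Sum>k\<in>J. \<Sum>l\<in>J. ?x k * (?x l * of_bool (k = l))) = Q"
      using d by (simp add: Q_def power2_eq_square flip: sum_distrib_left)
    have "(\<Sum>k\<in>J. \<Sum>l\<in>J. (?x i * ?x j * ?x k * ?x l) *
      (quartic_constant * (of_bool (i = j) * of_bool (k = l) + of_bool (i = k) * of_bool (j = l)
      + of_bool (i = l) * of_bool (j = k)))) = quartic_constant * (?x i * ?x j) *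
      (of_bool (i = j) * (\<Sum>k\<in>J. \<Sum>l\<in>J. ?x k * (?x l * of_bool (k = l)))
       + (\<Sum>k\<in>J. ?x k * of_bool (i = k)) * (\<Sum>l\<in>J. ?x l * of_bool (j = l))
       + (\<Sum>k\<in>J. ?x k * of_bool (j = k)) * (\<Sum>l\<in>J. ?x l * of_bool (i = l)))"
      unfolding sum_product sum_distrib_left[of "of_bool _"] unfolding sum.distrib[symmetric]
      unfolding sum_distrib_left
      by (intro sum.cong refl) (simp only: algebra_simps)
    then show "(\<Sum>k\<in>J. \<Sum>l\<in>J. (?x i * ?x j * ?x k * ?x l) *
      (quartic_constant * (of_bool (i = j) * of_bool (k = l) + of_bool (i = k) * of_bool (j = l)
      + of_bool (i = l) * of_bool (j = k)))) = quartic_constant *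
      ((?x i * ?x j) * of_bool (i = j) * Q + 2 * ((?x i)\<^sup>2 * (?x j)\<^sup>2))"
      unfolding d[OF ij(1)] d[OF ij(2)] Q by (simp add: algebra_simps power2_eq_square)
  qed
  also have "\<dots> = quartic_constant * ((\<Sum>i\<in>J. \<Sum>j\<in>J. (?x i * ?x j) * of_bool (i = j) * Q)
      + 2 * (\<Sum>i\<in>J. \<Sum>j\<in>J. (?x i)\<^sup>2 * (?x j)\<^sup>2))"
    by (simp only: sum_distrib_left sum.distrib distrib_left)
  also have "(\<Sum>i\<in>J. \<Sum>j\<in>J. (?x i)\<^sup>2 * (?x j)\<^sup>2) = Q * Q"
    unfolding Q_def sum_product ..
  also have "(\<Sum>i\<in>J. \<Sum>j\<in>J. (?x i * ?x j) * of_bool (i = j) * Q) = (\<Sum>i\<in>J. (?x i)\<^sup>2 * Q)"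
    by (intro sum.cong refl) (simp add: of_bool_def if_distrib[of "(*) _"] power2_eq_square
        flip: sum_distrib_right cong: if_cong)
  also have "\<dots> = Q * Q" by (simp add: Q_def sum_distrib_right)
  finally show ?thesis unfolding Q_def[symmetric] by (simp add: power2_eq_square)
qed

end

text \<open>
  A vector with entries \<open>b, 1, \<dots>, 1, 0, \<dots>, 0\<close> shall have the length of \<open>(s, \<dots>, s)\<close> and be concentrated
  enough. For \<open>4 \<le> n\<close> take \<open>s = 1\<close> and for \<open>b\<close> the integral part of the square root of \<open>n\<close>;
  in dimensions 2 and 3 this fails, and \<open>(5, 5)\<close>, \<open>(7, 1)\<close> and \<open>(3, 3, 3)\<close>, \<open>(5, 1, 1)\<close> serve instead.
\<close>

lemma exists_concentrated_square_sum:
  fixes n :: nat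
  assumes "1 \<le> n"
  shows "\<exists>s b k. 1 \<le> s \<and> s \<le> 5 \<and> b\<^sup>2 + k = n * s\<^sup>2 \<and> k < n
    \<and> 3 * n\<^sup>2 * s ^ 4 \<le> (n + 2) * (b ^ 4 + k)"
proof -
  consider "n = 1" | "n = 2" | "n = 3" | "4 \<le> n" using assms by linarith
  then show ?thesis
  proof cases
    case 1
    then show ?thesis by (intro exI[of _ 1] exI[of _ 1] exI[of _ 0]) simp
  next
    case 2
    then show ?thesis by (intro exI[of _ 5] exI[of _ 7] exI[of _ 1]) simp
  next
    case 3
    then show ?thesis by (intro exI[of _ 3] exI[of _ 5] exI[of _ 2]) simp
  next
    case 4
    have "\<exists>b. b\<^sup>2 \<le> n \<and> n < (b + 1)\<^sup>2"
    proof (induction n)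
      case 0
      show ?case by (intro exI[of _ 0]) simp
    next
      case (Suc n)
      then obtain b where b: "b\<^sup>2 \<le> n" "n < (b + 1)\<^sup>2" by blast
      show ?case
      proof (cases "Suc n < (b + 1)\<^sup>2")
        case True
        then show ?thesis using b by (intro exI[of _ b]) simp
      next
        case False
        then have "Suc n = (b + 1)\<^sup>2" using b by linarith
        then show ?thesis by (intro exI[of _ "b + 1"]) (simp add: power2_eq_square)
      qed
    qed
    then obtain b where b: "b\<^sup>2 \<le> n" "n < (b + 1)\<^sup>2" by blast
    obtain k where k: "n = b\<^sup>2 + k" using b(1) le_Suc_ex by blast
    have k2: "k \<le> 2 * b" using b(2) by (simp add: k power2_eq_square)
    have b2: "2 \<le> b"
    proof (rule ccontr)
      assume "\<not> 2 \<le> b"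
      then have "(b + 1)\<^sup>2 \<le> 2\<^sup>2" by (intro power_mono) auto
      then show False using b(2) 4 by simp
    qed
    have "3 * n\<^sup>2 \<le> (n + 2) * (b ^ 4 + k)"
    proof (cases "b = 2")
      case True
      then have "k \<le> 4" using k2 by simp
      then consider "k = 0" | "k = 1" | "k = 2" | "k = 3" | "k = 4" by linarith
      then show ?thesis by cases (simp_all add: k True)
    next
      case False
      then have b3: "3 \<le> b" using b2 by simp
      then have "3 * b \<le> b\<^sup>2" by (simp add: power2_eq_square)
      then have "3 * n \<le> 9 * b\<^sup>2" using k2 by (simp add: k)
      also have "\<dots> \<le> b\<^sup>2 * b\<^sup>2"
        using power_mono[OF b3, of 2] by (intro mult_right_mono) auto
      also have "\<dots> = b ^ 4" by (simp flip: power_add)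
      finally have "3 * n \<le> b ^ 4 + k" by simp
      then have "n * (3 * n) \<le> (n + 2) * (b ^ 4 + k)" by (intro mult_mono) auto
      then show ?thesis by (simp add: power2_eq_square mult.left_commute)
    qed
    moreover have "k < n" using b2 by (simp add: k)
    ultimately show ?thesis by (intro exI[of _ 1] exI[of _ b] exI[of _ k]) (simp add: k)
  qed
qed

lemma exists_shell_vectors:
  fixes J :: "'n::finite set"
  assumes "J \<noteq> {}"
  defines "n \<equiv> card J"
  shows "\<exists>\<rho> p q. 0 < \<rho> \<and> \<rho> \<le> 25 * int n \<and> p \<in> shell J \<rho> \<and> q \<in> shell J \<rho>
    \<and> (int n + 2) * quartic_sum J p \<le> 3 * \<rho>\<^sup>2 \<and> 3 * \<rho>\<^sup>2 \<le> (int n + 2) * quartic_sum J q"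
proof -
  have n: "1 \<le> n" using assms by (simp add: n_def Suc_le_eq card_gt_0_iff)
  obtain s b k :: nat where sbk: "1 \<le> s" "s \<le> 5" "b\<^sup>2 + k = n * s\<^sup>2" "k < n"
    "3 * n\<^sup>2 * s ^ 4 \<le> (n + 2) * (b ^ 4 + k)"
    using exists_concentrated_square_sum[OF n] by blast
  obtain i where i: "i \<in> J" using assms(1) by blast
  have "k \<le> card (J - {i})" using sbk(4) i by (simp add: n_def)
  then obtain K where K: "K \<subseteq> J - {i}" "card K = k" by (meson obtain_subset_with_card_n)
  define p where "p = (\<lambda>j. if j \<in> J then int s else 0)"
  define q where "q = (\<lambda>j. if j = i then int b else if j \<in> K then 1 else (0::int))"
  define \<rho> where "\<rho> = int (n * s\<^sup>2)"
  have sum_q: "(\<Sum>j\<in>J. q j ^ d) = int (b ^ d + k)" if "0 < d" for d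
  proof -
    have "(\<Sum>j\<in>J. q j ^ d) = q i ^ d + (\<Sum>j\<in>J - {i}. q j ^ d)"
      using i by (simp add: sum.remove)
    also have "(\<Sum>j\<in>J - {i}. q j ^ d) = (\<Sum>j\<in>J - {i}. if j \<in> K then 1 else 0)"
      using that by (intro sum.cong refl) (auto simp: q_def)
    also have "\<dots> = int k"
      using K by (simp add: sum.If_cases Int_absorb1)
    finally show ?thesis by (simp add: q_def)
  qed
  have "p \<in> shell J \<rho>" by (simp add: shell_def p_def \<rho>_def n_def)
  moreover have "q \<in> shell J \<rho>"
    using sum_q[of 2] sbk(3) i K by (auto simp: shell_def q_def[of] \<rho>_def)
  moreover have "0 < \<rho>" using n sbk(1) by (simp add: \<rho>_def)
  moreover have "s\<^sup>2 \<le> 5\<^sup>2" using sbk(2) by (rule power_mono) simp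
  then have "n * s\<^sup>2 \<le> n * 25" by (intro mult_left_mono) auto
  then have "int (n * s\<^sup>2) \<le> int (n * 25)" by (simp only: of_nat_le_iff)
  then have "\<rho> \<le> 25 * int n" by (simp only: \<rho>_def of_nat_mult of_nat_numeral mult.commute)
  moreover have "(int n + 2) * quartic_sum J p \<le> 3 * \<rho>\<^sup>2"
  proof -
    have "quartic_sum J p = int n * int s ^ 4" by (simp add: quartic_sum_def p_def n_def)
    moreover have "(int n + 2) * (int n * int s ^ 4) \<le> (3 * int n) * (int n * int s ^ 4)"
      using n by (intro mult_right_mono) auto
    moreover have "(3 * int n) * (int n * int s ^ 4) = 3 * \<rho>\<^sup>2"
      by (simp add: \<rho>_def power2_eq_square power4_eq_xxxx)
    ultimately show ?thesis by simp
  qed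
  moreover have "3 * \<rho>\<^sup>2 \<le> (int n + 2) * quartic_sum J q"
  proof -
    have q4: "quartic_sum J q = int (b ^ 4 + k)"
      unfolding quartic_sum_def by (rule sum_q) simp
    have "3 * \<rho>\<^sup>2 = int (3 * n\<^sup>2 * s ^ 4)"
      by (simp add: \<rho>_def power2_eq_square power4_eq_xxxx)
    also have "\<dots> \<le> int ((n + 2) * (b ^ 4 + k))" using sbk(5) by (simp only: of_nat_le_iff)
    also have "\<dots> = (int n + 2) * quartic_sum J q"
      unfolding q4 of_nat_mult by simp
    finally show ?thesis .
  qed
  ultimately show ?thesis by blast
qed

text \<open>
  Interpolation: the required mean of \<open>quartic_sum\<close> lies between the values at two integral vectors of
  the same length, so it is attained by distributing the weight \<open>1 - t\<close> uniformly over one level set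
  and \<open>t\<close> over the other.
\<close>

lemma exists_quartic_design:
  fixes J :: "'n::finite set"
  assumes "J \<noteq> {}"
  shows "\<exists>\<rho> h. quartic_design J \<rho> h \<and> (\<forall>x. 0 \<le> h x) \<and> 0 < \<rho> \<and> \<rho> \<le> 25 * int (card J)"
proof -
  obtain \<rho> p q where \<rho>: "0 < \<rho>" "\<rho> \<le> 25 * int (card J)" and pq: "p \<in> shell J \<rho>" "q \<in> shell J \<rho>"
    and ineq: "(int (card J) + 2) * quartic_sum J p \<le> 3 * \<rho>\<^sup>2" "3 * \<rho>\<^sup>2 \<le> (int (card J) + 2) * quartic_sum J q"
    using exists_shell_vectors[OF assms] by blast
  define P where "P = real_of_int (quartic_sum J p)"
  define Q where "Q = real_of_int (quartic_sum J q)"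
  define \<kappa> where "\<kappa> = 3 * (real_of_int \<rho>)\<^sup>2 / (real (card J) + 2)"
  have "real_of_int ((int (card J) + 2) * quartic_sum J p) \<le> real_of_int (3 * \<rho>\<^sup>2)"
    "real_of_int (3 * \<rho>\<^sup>2) \<le> real_of_int ((int (card J) + 2) * quartic_sum J q)"
    using ineq by (simp_all only: of_int_le_iff)
  then have \<kappa>: "P \<le> \<kappa>" "\<kappa> \<le> Q"
    by (simp_all add: P_def Q_def \<kappa>_def field_simps add_pos_pos)
  \<comment> \<open>If both levels coincide then t = 0 / 0 = 0, which is admissible because the required mean is then P.\<close>
  define t where "t = (\<kappa> - P) / (Q - P)"
  have t: "0 \<le> t" "t \<le> 1" "(1 - t) * P + t * Q = \<kappa>"
  proof -
    show "0 \<le> t" "t \<le> 1" using \<kappa> by (auto simp: t_def divide_le_eq_1)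
    show "(1 - t) * P + t * Q = \<kappa>"
    proof (cases "P = Q")
      case False
      have "(1 - t) * P + t * Q = P + t * (Q - P)" by (simp add: algebra_simps)
      also have "t * (Q - P) = \<kappa> - P" using False by (simp add: t_def)
      finally show ?thesis by simp
    qed (use \<kappa> in \<open>simp add: t_def\<close>)
  qed
  define level where "level = (\<lambda>x. {m \<in> shell J \<rho>. quartic_sum J m = x})"
  define u where "u = (\<lambda>y x. if x = y then 1 / real (card (level y)) else 0)"
  define h where "h = (\<lambda>x. (1 - t) * u (quartic_sum J p) x + t * u (quartic_sum J q) x)"
  have fin: "finite (shell J \<rho>)" by (rule finite_shell)
  have u: "(\<Sum>m\<in>shell J \<rho>. u (quartic_sum J r) (quartic_sum J m) * g (quartic_sum J m))
      = g (quartic_sum J r)" if "r \<in> shell J \<rho>" for r and g :: "int \<Rightarrow> real"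
  proof -
    let ?y = "quartic_sum J r"
    have "r \<in> level ?y" "finite (level ?y)" using that fin by (simp_all add: level_def)
    then have c: "0 < card (level ?y)" by (auto simp: card_gt_0_iff)
    have "(\<Sum>m\<in>shell J \<rho>. u ?y (quartic_sum J m) * g (quartic_sum J m))
        = (\<Sum>m\<in>shell J \<rho>. if quartic_sum J m = ?y then g ?y / real (card (level ?y)) else 0)"
      by (intro sum.cong refl) (auto simp: u_def)
    also have "\<dots> = (\<Sum>m\<in>level ?y. g ?y / real (card (level ?y)))"
      unfolding level_def by (rule sum.inter_filter[OF fin, symmetric])
    also have "\<dots> = g ?y" using c by simp
    finally show ?thesis .
  qed
  have h: "(\<Sum>m\<in>shell J \<rho>. h (quartic_sum J m) * g (quartic_sum J m))
      = (1 - t) * g (quartic_sum J p) + t * g (quartic_sum J q)" for g :: "int \<Rightarrow> real"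
    unfolding h_def distrib_right sum.distrib mult.assoc sum_distrib_left[symmetric]
    by (simp only: u[OF pq(1)] u[OF pq(2)])
  have "quartic_design J \<rho> h"
  proof
    show "(\<Sum>m\<in>shell J \<rho>. h (quartic_sum J m)) = 1"
      using h[of "\<lambda>_. 1"] by simp
    show "(\<Sum>m\<in>shell J \<rho>. h (quartic_sum J m) * real_of_int (quartic_sum J m))
        = 3 * (real_of_int \<rho>)\<^sup>2 / (real (card J) + 2)"
      using h[of real_of_int] t(3) by (simp add: P_def Q_def \<kappa>_def)
  qed (rule assms)
  moreover have "0 \<le> h x" for x
    using t by (simp add: h_def u_def)
  ultimately show ?thesis using \<rho> by blast
qed

lemma exists_character_frame:
  fixes M :: "('n::finite \<Rightarrow> int) set"
  assumes "finite M" "2 * card M \<le> DIM('b::euclidean_space)"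
  shows "\<exists>e f :: ('n \<Rightarrow> int) \<Rightarrow> 'b. torus_characters M e f"
proof -
  have "card (M \<times> (UNIV :: bool set)) \<le> card (Basis :: 'b set)"
    using assms(2) by (simp add: card_cartesian_product mult.commute)
  then obtain g where g: "g ` (M \<times> (UNIV :: bool set)) \<subseteq> (Basis :: 'b set)"
    "inj_on g (M \<times> (UNIV :: bool set))"
    using card_le_inj[of "M \<times> (UNIV :: bool set)" "Basis :: 'b set"] assms(1) by auto
  have ip: "g (m, x) \<bullet> g (m', x') = (if m = m' \<and> x = x' then 1 else 0)"
    if "m \<in> M" "m' \<in> M" for m m' x x'
  proof -
    have "g (m, x) \<in> Basis" "g (m', x') \<in> Basis" using g(1) that by auto
    then show ?thesis
      using inj_on_eq_iff[OF g(2), of "(m, x)" "(m', x')"] that by (simp add: inner_Basis)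
  qed
  have "torus_characters M (\<lambda>m. g (m, True)) (\<lambda>m. g (m, False))"
    by unfold_locales (auto simp: ip assms(1))
  then show ?thesis by blast
qed

text \<open>
  The left-hand side bounds the dimension of the sum of the planes for a shell with
  \<open>\<rho> \<le> 25 * n\<close>. The comparison uses \<open>50 * n + 1 \<le> 2\<^sup>6 * l \<le> l\<^sup>7\<close>.
\<close>

lemma shell_count_bound:
  fixes l n :: nat
  assumes "2 \<le> l" "n < l"
  shows "2 * (50 * n + 1) ^ n \<le> l ^ l ^ 4"
proof -
  have "2 ^ 6 \<le> l ^ 6" using assms(1) by (rule power_mono) simp
  then have "64 * l \<le> l ^ 6 * l" by simp
  then have "50 * n + 1 \<le> l ^ 6 * l"
    using assms(2) by linarith
  then have "50 * n + 1 \<le> l ^ 7"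
    using power_add[of l 6 1] by simp
  then have "(50 * n + 1) ^ n \<le> (l ^ 7) ^ n" by (rule power_mono) simp
  also have "\<dots> \<le> (l ^ 7) ^ l" using assms by (intro power_increasing) auto
  finally have "2 * (50 * n + 1) ^ n \<le> l * (l ^ 7) ^ l"
    using assms(1) by (intro mult_mono) auto
  also have "\<dots> = l ^ (7 * l + 1)"
    unfolding power_add power_mult power_one_right by (rule mult.commute)
  also have "\<dots> \<le> l ^ l ^ 4"
  proof (rule power_increasing)
    show "7 * l + 1 \<le> l ^ 4"
    proof (cases "l = 2")
      case False
      then have "3 ^ 3 \<le> l ^ 3" using assms(1) by (intro power_mono) auto
      then have "27 * l \<le> l ^ 3 * l" by simp
      moreover have "l ^ 3 * l = l ^ 4" using power_add[of l 3 1] by simp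
      ultimately show ?thesis using assms(1) by linarith
    qed simp
  qed (use assms in simp)
  finally show ?thesis .
qed

section \<open>The immersion\<close>

theorem mainTheorem5:
  fixes k l :: nat and J :: "'n::finite set"
  assumes "l \<ge> 1" and "k \<ge> l ^ (l ^ 4)"
    and "DIM('a::euclidean_space) = k + 1"
    and "card J = l - 1"
    and "DIM('b::euclidean_space) = k + l"
  shows "(\<exists>F :: 'a \<times> (complex ^ 'n) \<Rightarrow> 'b.
            immersion_on (sphere 0 1 \<times> torus J) F
            \<and> F ` (sphere 0 1 \<times> torus J) \<subseteq> cball 0 1
            \<and> curv_perp (sphere 0 1 \<times> torus J) F
                \<le> ereal (1 + 2 * sqrt ((3 * real l - 3) / (real l + 1))))
         \<and> 1 + 2 * sqrt ((3 * real l - 3) / (real l + 1)) < 4.5"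
proof
  have dim: "DIM('a) + card J = DIM('b)" using assms by simp
  have arg: "0 \<le> (3 * real l - 3) / (real l + 1)" using assms(1) by simp
  define c where "c = sqrt ((3 * real l - 3) / (real l + 1))"
  have c: "0 \<le> c" "c\<^sup>2 = (3 * real l - 3) / (real l + 1)"
    using arg by (simp_all add: c_def)
  have "(3 * real l - 3) / (real l + 1) < 3" by (simp add: field_simps)
  then have "c\<^sup>2 < (1.75)\<^sup>2" unfolding c(2) by (rule less_trans) (simp add: power2_eq_square)
  then have "c < 1.75" by (rule power_less_imp_less_base) simp
  then show "1 + 2 * sqrt ((3 * real l - 3) / (real l + 1)) < 4.5"
    unfolding c_def by simp
  show "\<exists>F :: 'a \<times> (complex ^ 'n) \<Rightarrow> 'b.
            immersion_on (sphere 0 1 \<times> torus J) F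
            \<and> F ` (sphere 0 1 \<times> torus J) \<subseteq> cball 0 1
            \<and> curv_perp (sphere 0 1 \<times> torus J) F
                \<le> ereal (1 + 2 * sqrt ((3 * real l - 3) / (real l + 1)))"
    unfolding c_def[symmetric]
  proof (cases "J = {}")
    case True
    \<comment> \<open>The torus is a point, and the tube is the unit sphere itself.\<close>
    obtain e f :: "('n \<Rightarrow> int) \<Rightarrow> 'b" where "torus_characters {} e f"
      using exists_character_frame[of "{} :: ('n \<Rightarrow> int) set", where 'b = 'b] by auto
    then interpret torus_characters J "{}" e f .
    show "\<exists>F :: 'a \<times> (complex ^ 'n) \<Rightarrow> 'b. immersion_on (sphere 0 1 \<times> torus J) F
        \<and> F ` (sphere 0 1 \<times> torus J) \<subseteq> cball 0 1
        \<and> curv_perp (sphere 0 1 \<times> torus J) F \<le> ereal (1 + 2 * c)"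
      by (rule tube_immersion_exists[OF dim _ c(1)]) (simp_all add: True)
  next
    case False
    define n where "n = card J"
    have n: "0 < n" "n < l" "2 \<le> l"
      using False assms(1,4) by (auto simp: n_def card_gt_0_iff)
    have c2: "c\<^sup>2 = 3 * real n / (real n + 2)"
      using assms(1,4) by (simp add: c(2) n_def of_nat_diff algebra_simps)
    obtain \<rho> h where d: "quartic_design J \<rho> h" "\<And>x. 0 \<le> h x" "0 < \<rho>" "\<rho> \<le> 25 * int n"
      using exists_quartic_design[OF False] unfolding n_def by blast
    interpret quartic_design J \<rho> h by (rule d(1))
    let ?M = "shell J \<rho>"
    have "card ?M \<le> nat (2 * \<rho> + 1) ^ n"
      unfolding n_def by (rule card_shell_le) (use d(3) in simp)
    also have "\<dots> \<le> (50 * n + 1) ^ n"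
      using d(4) by (intro power_mono) auto
    finally have "2 * card ?M \<le> 2 * (50 * n + 1) ^ n" by simp
    also have "\<dots> \<le> l ^ l ^ 4" by (rule shell_count_bound[OF n(3,2)])
    finally have "2 * card ?M \<le> DIM('b)" using assms(2,5) by simp
    then obtain e f :: "('n \<Rightarrow> int) \<Rightarrow> 'b" where "torus_characters ?M e f"
      using exists_character_frame[OF finite_shell] by blast
    then interpret torus_characters J ?M e f .
    define a where "a = (\<lambda>m. sqrt (h (quartic_sum J m)))"
    have a: "(a m)\<^sup>2 = h (quartic_sum J m)" for m using d(2) by (simp add: a_def)
    have a_mean: "(\<Sum>m\<in>?M. (a m)\<^sup>2 * g m) = mean g" for g
      by (simp add: a mean_def)
    show "\<exists>F :: 'a \<times> (complex ^ 'n) \<Rightarrow> 'b. immersion_on (sphere 0 1 \<times> torus J) F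
        \<and> F ` (sphere 0 1 \<times> torus J) \<subseteq> cball 0 1
        \<and> curv_perp (sphere 0 1 \<times> torus J) F \<le> ereal (1 + 2 * c)"
    proof (rule tube_immersion_exists[OF dim _ c(1)])
      show "(\<Sum>m\<in>?M. (a m)\<^sup>2) \<le> 1" using total_weight by (simp add: a)
    next
      fix \<xi> :: "real ^ 'n"
      show "(\<Sum>m\<in>?M. (a m)\<^sup>2 * pairing J m \<xi> ^ 4)
          \<le> c\<^sup>2 * (\<Sum>m\<in>?M. (a m)\<^sup>2 * (pairing J m \<xi>)\<^sup>2)\<^sup>2"
        unfolding a_mean mean_pairing_square mean_pairing_quartic quartic_constant_def c2
        using n(1) by (simp add: n_def[symmetric] power2_eq_square mult_ac)
    next
      fix \<xi> :: "real ^ 'n" and j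
      assume 0: "(\<Sum>m\<in>?M. (a m)\<^sup>2 * (pairing J m \<xi>)\<^sup>2) = 0" and j: "j \<in> J"
      have "(\<Sum>j\<in>J. (\<xi> $ j)\<^sup>2) = 0"
        using 0 d(3) False unfolding a_mean mean_pairing_square by simp
      then show "\<xi> $ j = 0"
        using j by (simp add: sum_nonneg_eq_0_iff)
    qed
  qed
qed

end
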